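(* Let $(\phi,\psi)$ be a solution on $(0,T)$ of the projected Allen–Cahn system with projected Allen–Cahn type dynamic boundary condition $$\phi_t=-\gamma_1\,\mathbf{P}_1\mu \ \text{ in } \Omega\times(0,T),\qquad \mu=-\kappa^2\Delta\phi+f(\phi)\ \text{ in }\Omega\times(0,T),\qquad \partial_{\mathbf n}\mu=0 \ \text{ on }\Gamma\times(0,T),$$ $$\phi|_\Gamma=\psi\ \text{ on }\Gamma\times(0,T),\qquad \psi_t=-\gamma_2\,\mathbf{P}_2\mu_\Gamma\ \text{ on }\Gamma\times(0,T),\qquad \mu_\Gamma=-\kappa^2\Delta_\Gamma\psi+g(\psi)+\kappa^2\partial_{\mathbf n}\phi\ \text{ on }\Gamma\times(0,T).$$ Then the total energy $$E^{\text{total}}(\phi,\psi)=\int_\Omega\Big(\frac{\kappa^2}{2}|\nabla\phi|^2+F(\phi)\Big)\mathrm d\mathbf x+\int_\Gamma\Big(\frac{\kappa^2}{2}|\nabla_\Gamma\psi|^2+G(\psi)\Big)\mathrm dS$$ satisfies, for all $t\in(0,T)$, $$\frac{\mathrm d}{\mathrm dt}E^{\text{total}}(\phi(t),\psi(t))\le 0.$$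
   Context: $\Omega\subset\mathbb R^d$ is a bounded domain with boundary $\Gamma$, smooth enough for the Gauss–Green formulas in $\Omega$ and on the closed hypersurface $\Gamma$; $\mathbf n$ is the outward unit normal to $\Gamma$; $T>0$ is finite; $\gamma_1,\gamma_2,\kappa>0$ are constants. $\nabla_\Gamma$ and $\Delta_\Gamma$ denote the tangential gradient and the Laplace–Beltrami operator on $\Gamma$. The unknowns are $\phi:\Omega\times(0,T)\to\mathbb R$ and $\psi:\Gamma\times(0,T)\to\mathbb R$; solutions are understood to be smooth enough that all expressions make classical sense (including differentiation in time under the integral). The nonlinearities are $f=F'$ with $F(\phi)=\tfrac14(\phi^2-1)^2$, i.e. $f(\phi)=\phi^3-\phi$, and $g=G'$, where the surface potential $G$ is either the double-well potential $G(\psi)=\tfrac14(\psi^2-1)^2$ or the moving contact line potential $G(\psi)=-\tfrac{\tilde\gamma}{2}\cos(\theta_s)\sin(\tfrac{\pi}{2}\psi)$ with real constants $\tilde\gamma,\theta_s$. The projections are $$\mathbf P_1u:=u-\frac1{|\Omega|}\int_\Omega u(\mathbf x)\,\mathrm d\mathbf x\quad(u\in L^2(\Omega)),\qquad \mathbf P_2u:=u-\frac1{|\Gamma|}\int_\Gamma u\,\mathrm dS\quad(u\in L^2(\Gamma)),$$ where $|\Omega|$ is the volume of $\Omega$ and $|\Gamma|$ the surface measure of $\Gamma$. *)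

theory Defs
  imports "HOL-Analysis.Analysis"
begin

section \<open>Hausdorff measure and surface measure\<close>

text \<open>
  Size-\<open>\<delta>\<close> Hausdorff content in dimension \<open>k\<close>. The factor \<open>unit_ball_vol k * (diam / 2) ^ k\<close> is
  the volume of the \<open>k\<close>-dimensional ball of the same diameter, so that the \<open>k\<close>-dimensional measure
  is the usual \<open>k\<close>-dimensional area on \<open>k\<close>-dimensional submanifolds. Empty covering sets
  are treated separately because \<open>0 ^ 0 = 1\<close>.
\<close>

definition hausdorff_content :: "nat \<Rightarrow> real \<Rightarrow> 'a::metric_space set \<Rightarrow> ennreal" where
  "hausdorff_content k \<delta> A =
     (INF C \<in> {C :: nat \<Rightarrow> 'a set. A \<subseteq> (\<Union>j. C j) \<and> (\<forall>j. bounded (C j) \<and> diameter (C j) \<le> \<delta>)}.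
        \<Sum>j. if C j = {} then 0 else ennreal (unit_ball_vol (real k) * (diameter (C j) / 2) ^ k))"

definition hausdorff_outer :: "nat \<Rightarrow> 'a::metric_space set \<Rightarrow> ennreal" where
  "hausdorff_outer k A = (SUP \<delta> \<in> {0<..}. hausdorff_content k \<delta> A)"

text \<open>
  The outer measure is additive on sets of positive distance, so Borel sets are Caratheodory
  measurable and the measure below agrees with the outer measure on them.
\<close>

definition hausdorff_measure :: "nat \<Rightarrow> 'a::metric_space measure" where
  "hausdorff_measure k = measure_of UNIV (sets borel) (hausdorff_outer k)"

definition surface_measure :: "'a::euclidean_space measure" where
  "surface_measure = hausdorff_measure (DIM('a) - 1)"

section \<open>Calculus in the bulk\<close>

definition gradient :: "('a::euclidean_space \<Rightarrow> real) \<Rightarrow> 'a \<Rightarrow> 'a" where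
  "gradient u x = (\<Sum>i\<in>Basis. frechet_derivative u (at x) i *\<^sub>R i)"

definition divergence :: "('a::euclidean_space \<Rightarrow> 'a) \<Rightarrow> 'a \<Rightarrow> real" where
  "divergence V x = (\<Sum>i\<in>Basis. frechet_derivative V (at x) i \<bullet> i)"

definition laplacian :: "('a::euclidean_space \<Rightarrow> real) \<Rightarrow> 'a \<Rightarrow> real" where
  "laplacian u = divergence (gradient u)"

lemma gradient_eqI:
  assumes "GDERIV u x :> D"
  shows "gradient u x = D"
proof -
  have "frechet_derivative u (at x) = (\<lambda>h. h \<bullet> D)"
    using assms frechet_derivative_at unfolding gderiv_def by metis
  then show ?thesis
    by (simp add: gradient_def inner_commute[of _ D] euclidean_representation)
qed

text \<open>
  The class \<open>C\<^sup>1\<close> of the closure of a bounded open set \<open>\<Omega>\<close>: the function and its first partial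
  derivatives are defined in \<open>\<Omega>\<close> and uniformly continuous there, equivalently, they extend
  continuously to the closure. Boundary values are those of this extension.
\<close>

definition C1_closure :: "'a::euclidean_space set \<Rightarrow> ('a \<Rightarrow> 'b::real_normed_vector) \<Rightarrow> bool" where
  "C1_closure \<Omega> u \<longleftrightarrow>
     (\<forall>x\<in>\<Omega>. u differentiable (at x)) \<and>
     uniformly_continuous_on \<Omega> u \<and>
     (\<forall>i\<in>Basis. uniformly_continuous_on \<Omega> (\<lambda>x. frechet_derivative u (at x) i))"

definition C2_closure :: "'a::euclidean_space set \<Rightarrow> ('a \<Rightarrow> real) \<Rightarrow> bool" where
  "C2_closure \<Omega> u \<longleftrightarrow> C1_closure \<Omega> u \<and> C1_closure \<Omega> (gradient u)"

definition boundary_trace :: "'a::t2_space set \<Rightarrow> ('a \<Rightarrow> 'b::t2_space) \<Rightarrow> 'a \<Rightarrow> 'b" where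
  "boundary_trace \<Omega> u x = Lim (at x within \<Omega>) u"

definition normal_derivative ::
  "'a::euclidean_space set \<Rightarrow> ('a \<Rightarrow> 'a) \<Rightarrow> ('a \<Rightarrow> real) \<Rightarrow> 'a \<Rightarrow> real" where
  "normal_derivative \<Omega> n u x = boundary_trace \<Omega> (gradient u) x \<bullet> n x"

section \<open>Calculus on a hypersurface\<close>

text \<open>
  On a \<open>C\<^sup>1\<close> hypersurface the velocities of curves already form a linear space; the span
  only makes this hold for arbitrary sets.
\<close>

definition tangent_space :: "'a::euclidean_space set \<Rightarrow> 'a \<Rightarrow> 'a set" where
  "tangent_space \<Gamma> x =
     span {v. \<exists>c :: real \<Rightarrow> 'a. c 0 = x \<and> (\<forall>s. c s \<in> \<Gamma>) \<and> (c has_vector_derivative v) (at 0)}"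

text \<open>
  The tangential gradient is the tangent vector representing the differential of a function that
  is defined on \<open>\<Gamma>\<close> only.
\<close>

definition has_tangential_gradient ::
  "'a::euclidean_space set \<Rightarrow> ('a \<Rightarrow> real) \<Rightarrow> 'a \<Rightarrow> 'a \<Rightarrow> bool" where
  "has_tangential_gradient \<Gamma> u x v \<longleftrightarrow>
     v \<in> tangent_space \<Gamma> x \<and> (u has_derivative (\<lambda>h. h \<bullet> v)) (at x within \<Gamma>)"

definition tangential_gradient ::
  "'a::euclidean_space set \<Rightarrow> ('a \<Rightarrow> real) \<Rightarrow> 'a \<Rightarrow> 'a" where
  "tangential_gradient \<Gamma> u x = (THE v. has_tangential_gradient \<Gamma> u x v)"

lemma has_tangential_gradient_unique:
  assumes "has_tangential_gradient \<Gamma> u x v" "has_tangential_gradient \<Gamma> u x w"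
  shows "v = w"
proof -
  have curve: "z \<bullet> v = z \<bullet> w"
    if c: "c 0 = x" "\<forall>s. c s \<in> \<Gamma>" "(c has_vector_derivative z) (at 0)" for z and c :: "real \<Rightarrow> 'a"
  proof -
    have *: "((u \<circ> c) has_derivative (\<lambda>h. (h *\<^sub>R z) \<bullet> y)) (at 0)"
      if "has_tangential_gradient \<Gamma> u x y" for y
    proof -
      have "(u has_derivative (\<lambda>h. h \<bullet> y)) (at (c 0) within range c)"
        using that c unfolding has_tangential_gradient_def
        by (auto intro: has_derivative_subset)
      moreover have "(c has_derivative (\<lambda>h. h *\<^sub>R z)) (at 0)"
        using c(3) by (simp add: has_vector_derivative_def)
      ultimately show ?thesis
        using diff_chain_within[of c "\<lambda>h. h *\<^sub>R z" 0 UNIV u "\<lambda>h. h \<bullet> y"]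
        by (simp add: o_def)
    qed
    have "(\<lambda>h. (h *\<^sub>R z) \<bullet> v) = (\<lambda>h. (h *\<^sub>R z) \<bullet> w)"
      using *[OF assms(1)] *[OF assms(2)] has_derivative_unique by blast
    from fun_cong[OF this, of 1] show ?thesis by simp
  qed
  have "orthogonal (v - w) z" if "z \<in> tangent_space \<Gamma> x" for z
  proof (rule orthogonal_to_span[OF that[unfolded tangent_space_def]])
    fix y assume "y \<in> {z. \<exists>c. c 0 = x \<and> (\<forall>s. c s \<in> \<Gamma>) \<and> (c has_vector_derivative z) (at 0)}"
    then show "orthogonal (v - w) y"
      using curve[of _ y] by (auto simp: orthogonal_def inner_diff_right inner_commute[of _ y])
  qed
  moreover have "v - w \<in> tangent_space \<Gamma> x"
    using assms unfolding has_tangential_gradient_def tangent_space_def by (auto intro: span_diff)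
  ultimately show ?thesis
    by (metis orthogonal_self right_minus_eq)
qed

text \<open>
  For tangential \<open>V\<close> this is the surface divergence, the trace over the tangent space of the
  derivative of \<open>V\<close> along \<open>\<Gamma>\<close>, written in Cartesian coordinates of the ambient space.
\<close>

definition surface_divergence ::
  "'a::euclidean_space set \<Rightarrow> ('a \<Rightarrow> 'a) \<Rightarrow> 'a \<Rightarrow> real" where
  "surface_divergence \<Gamma> V x = (\<Sum>i\<in>Basis. tangential_gradient \<Gamma> (\<lambda>y. V y \<bullet> i) x \<bullet> i)"

definition laplace_beltrami ::
  "'a::euclidean_space set \<Rightarrow> ('a \<Rightarrow> real) \<Rightarrow> 'a \<Rightarrow> real" where
  "laplace_beltrami \<Gamma> u = surface_divergence \<Gamma> (tangential_gradient \<Gamma> u)"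

definition C1_surface :: "'a::euclidean_space set \<Rightarrow> ('a \<Rightarrow> real) \<Rightarrow> bool" where
  "C1_surface \<Gamma> u \<longleftrightarrow>
     (\<forall>x\<in>\<Gamma>. \<exists>v. has_tangential_gradient \<Gamma> u x v) \<and> continuous_on \<Gamma> (tangential_gradient \<Gamma> u)"

definition C1_tangential_field :: "'a::euclidean_space set \<Rightarrow> ('a \<Rightarrow> 'a) \<Rightarrow> bool" where
  "C1_tangential_field \<Gamma> V \<longleftrightarrow>
     (\<forall>x\<in>\<Gamma>. V x \<in> tangent_space \<Gamma> x) \<and> (\<forall>i\<in>Basis. C1_surface \<Gamma> (\<lambda>y. V y \<bullet> i))"

definition C2_surface :: "'a::euclidean_space set \<Rightarrow> ('a \<Rightarrow> real) \<Rightarrow> bool" where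
  "C2_surface \<Gamma> u \<longleftrightarrow> C1_surface \<Gamma> u \<and> C1_tangential_field \<Gamma> (tangential_gradient \<Gamma> u)"

section \<open>Domains\<close>

text \<open>Local defining functions: near each boundary point \<open>\<Omega>\<close> is a strict sublevel set.\<close>

definition C1_boundary :: "'a::euclidean_space set \<Rightarrow> bool" where
  "C1_boundary \<Omega> \<longleftrightarrow>
     (\<forall>x\<in>frontier \<Omega>. \<exists>U \<rho>. open U \<and> x \<in> U \<and>
        (\<forall>y\<in>U. \<rho> differentiable (at y) \<and> gradient \<rho> y \<noteq> 0) \<and>
        continuous_on U (gradient \<rho>) \<and> \<Omega> \<inter> U = {y\<in>U. \<rho> y < 0})"

definition outward_unit_normal :: "'a::euclidean_space set \<Rightarrow> 'a \<Rightarrow> 'a \<Rightarrow> bool" where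
  "outward_unit_normal \<Omega> x \<nu> \<longleftrightarrow>
     norm \<nu> = 1 \<and> (\<forall>v\<in>tangent_space (frontier \<Omega>) x. v \<bullet> \<nu> = 0) \<and>
     (\<exists>\<epsilon>>0. \<forall>s\<in>{0<..<\<epsilon>}. x - s *\<^sub>R \<nu> \<in> \<Omega> \<and> x + s *\<^sub>R \<nu> \<notin> closure \<Omega>)"

text \<open>
  Validity of the Gauss--Green formulas in \<open>\<Omega>\<close> and on the closed hypersurface
  \<open>frontier \<Omega>\<close>; the latter has no boundary, so there is no boundary term.
\<close>

definition gauss_green_bulk :: "'a::euclidean_space set \<Rightarrow> ('a \<Rightarrow> 'a) \<Rightarrow> bool" where
  "gauss_green_bulk \<Omega> n \<longleftrightarrow>
     (\<forall>V. C1_closure \<Omega> V \<longrightarrow>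
        (LINT x:\<Omega>|lborel. divergence V x) =
        (LINT x:frontier \<Omega>|surface_measure. boundary_trace \<Omega> V x \<bullet> n x))"

definition gauss_green_surface :: "'a::euclidean_space set \<Rightarrow> bool" where
  "gauss_green_surface \<Gamma> \<longleftrightarrow>
     (\<forall>V. C1_tangential_field \<Gamma> V \<longrightarrow> (LINT x:\<Gamma>|surface_measure. surface_divergence \<Gamma> V x) = 0)"

section \<open>The projected Allen--Cahn system\<close>

text \<open>
  \<open>u\<close> has a time derivative on \<open>(0,T) \<times> S\<close> that extends continuously to \<open>(0,T) \<times> closure S\<close>
  (for bounded \<open>S\<close>).
\<close>

definition time_C1 :: "real \<Rightarrow> 'a::metric_space set \<Rightarrow> (real \<Rightarrow> 'a \<Rightarrow> 'b::real_normed_vector) \<Rightarrow> bool" where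
  "time_C1 T S u \<longleftrightarrow>
     (\<forall>t\<in>{0<..<T}. \<forall>x\<in>S. (\<lambda>s. u s x) differentiable (at t)) \<and>
     (\<forall>a b. 0 < a \<longrightarrow> b < T \<longrightarrow>
        uniformly_continuous_on ({a..b} \<times> S) (\<lambda>(t, x). vector_derivative (\<lambda>s. u s x) (at t)))"

definition double_well :: "real \<Rightarrow> real" where
  "double_well s = (s\<^sup>2 - 1)\<^sup>2 / 4"

definition moving_contact_line :: "real \<Rightarrow> real \<Rightarrow> real \<Rightarrow> real" where
  "moving_contact_line \<gamma> \<theta> s = - (\<gamma> / 2) * cos \<theta> * sin (pi / 2 * s)"

lemma deriv_double_well: "deriv double_well s = s ^ 3 - s"
  unfolding double_well_def
  by (rule DERIV_imp_deriv)
     (auto intro!: derivative_eq_intros simp: field_simps power2_eq_square power3_eq_cube)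

definition mean_free :: "'a measure \<Rightarrow> 'a set \<Rightarrow> ('a \<Rightarrow> real) \<Rightarrow> 'a \<Rightarrow> real" where
  "mean_free M S u x = u x - 1 / measure M S * (LINT y:S|M. u y)"

abbreviation proj_bulk :: "'a::euclidean_space set \<Rightarrow> ('a \<Rightarrow> real) \<Rightarrow> 'a \<Rightarrow> real" where
  "proj_bulk \<equiv> mean_free lborel"

abbreviation proj_surface :: "'a::euclidean_space set \<Rightarrow> ('a \<Rightarrow> real) \<Rightarrow> 'a \<Rightarrow> real" where
  "proj_surface \<equiv> mean_free surface_measure"

definition total_energy ::
  "real \<Rightarrow> (real \<Rightarrow> real) \<Rightarrow> 'a::euclidean_space set \<Rightarrow> ('a \<Rightarrow> real) \<Rightarrow> ('a \<Rightarrow> real) \<Rightarrow> real" where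
  "total_energy \<kappa> G \<Omega> \<phi> \<psi> =
     (LINT x:\<Omega>|lborel. \<kappa>\<^sup>2 / 2 * (norm (gradient \<phi> x))\<^sup>2 + double_well (\<phi> x)) +
     (LINT x:frontier \<Omega>|surface_measure.
        \<kappa>\<^sup>2 / 2 * (norm (tangential_gradient (frontier \<Omega>) \<psi> x))\<^sup>2 + G (\<psi> x))"

end

theory Submission
  imports Defs
begin

text \<open>
  Differentiating the energy under the integral signs and applying the Gauss--Green formulas to
  \<open>\<phi>\<^sub>t \<nabla>\<phi>\<close> in the domain and to \<open>\<psi>\<^sub>t \<nabla>\<^sub>\<Gamma>\<psi>\<close> on the boundary turns its derivative into
  \<open>\<integral>\<^sub>\<Omega> \<mu> \<phi>\<^sub>t + \<integral>\<^sub>\<Gamma> \<mu>\<^sub>\<Gamma> \<psi>\<^sub>t\<close>, the normal derivative terms cancelling; by the equations this is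
  \<open>- \<gamma>\<^sub>1 \<integral>\<^sub>\<Omega> \<mu> P\<^sub>1 \<mu> - \<gamma>\<^sub>2 \<integral>\<^sub>\<Gamma> \<mu>\<^sub>\<Gamma> P\<^sub>2 \<mu>\<^sub>\<Gamma>\<close>, and projections are nonnegative. The delicate point is
  that \<open>\<psi>\<^sub>t\<close> is differentiable along \<open>\<Gamma>\<close> with tangential gradient \<open>\<partial>\<^sub>t \<nabla>\<^sub>\<Gamma>\<psi>\<close>, which is obtained from the
  regularity of \<open>\<phi>\<^sub>t\<close> up to the boundary, because \<open>\<psi>\<^sub>t\<close> is its trace.
\<close>

section \<open>Bounded continuous integrands\<close>

text \<open>The hypotheses say nothing direct about spatial derivatives of \<phi>_t and \<psi>_t, so
  these have to be produced. In the bulk, \<phi>_t is an affine image of \<mu> and thus as regular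
  as \<mu>; exchanging limits on a small ball identifies its gradient with the time derivative of
  the gradient of \<phi>. That exchange rests on the mean value inequality along segments, and
  segments between points of \<Gamma> leave \<Gamma>, so it cannot be repeated on the boundary. The
  substitute is to show that the trace of a function of class C1 up to the boundary is
  differentiable along \<Gamma>, by joining two boundary points through a short detour inside
  \<Omega>. All limits in time are controlled by remainders that are uniform in space: one such
  estimate passes under an integral, to the boundary, and through spatial differentiation.\<close>

text \<open>A common integrability criterion for both domains of integration: on the bounded set
  \<Omega> it comes from uniform continuity, on \<Gamma> from compactness.\<close>

definition bounded_continuous_on :: "'a::topological_space set \<Rightarrow> ('a \<Rightarrow> 'b::metric_space) \<Rightarrow> bool" where
  "bounded_continuous_on S u \<longleftrightarrow> continuous_on S u \<and> bounded (u ` S)"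

lemma bounded_continuous_on_const: "bounded_continuous_on S (\<lambda>x. c)"
  by (simp add: bounded_continuous_on_def image_constant_conv)

lemma bounded_continuous_on_compact:
  "compact S \<Longrightarrow> continuous_on S u \<Longrightarrow> bounded_continuous_on S u"
  unfolding bounded_continuous_on_def
  by (intro conjI compact_imp_bounded compact_continuous_image)

lemma bounded_continuous_on_uniform:
  fixes u :: "'a::heine_borel \<Rightarrow> 'b::heine_borel"
  assumes "bounded S" "uniformly_continuous_on S u"
  shows "bounded_continuous_on S u"
  unfolding bounded_continuous_on_def
  by (intro conjI uniformly_continuous_imp_continuous bounded_uniformly_continuous_image assms)

lemma bounded_continuous_on_compose:
  fixes u :: "'a::topological_space \<Rightarrow> 'b::heine_borel"
  assumes "bounded_continuous_on S u" "continuous_on UNIV H"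
  shows "bounded_continuous_on S (\<lambda>x. H (u x))"
proof -
  have "compact (closure (u ` S))"
    using assms(1) by (simp add: bounded_continuous_on_def)
  then have "bounded (H ` closure (u ` S))"
    using assms(2) by (meson compact_continuous_image compact_imp_bounded continuous_on_subset subset_UNIV)
  then have "bounded ((\<lambda>x. H (u x)) ` S)"
    by (rule bounded_subset) (use closure_subset in blast)
  moreover have "continuous_on S (\<lambda>x. H (u x))"
    using assms by (auto simp: bounded_continuous_on_def intro: continuous_on_compose2[of UNIV H])
  ultimately show ?thesis
    by (simp add: bounded_continuous_on_def)
qed

lemma bounded_continuous_on_Pair:
  assumes "bounded_continuous_on S u" "bounded_continuous_on S v"
  shows "bounded_continuous_on S (\<lambda>x. (u x, v x))"
proof -
  have "bounded (u ` S \<times> v ` S)"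
    using assms by (intro bounded_Times) (auto simp: bounded_continuous_on_def)
  then have "bounded ((\<lambda>x. (u x, v x)) ` S)"
    by (rule bounded_subset) auto
  then show ?thesis
    using assms by (auto simp: bounded_continuous_on_def intro: continuous_intros)
qed

lemma bounded_continuous_on_compose_Pair:
  fixes u :: "'a::topological_space \<Rightarrow> 'b::heine_borel" and v :: "'a \<Rightarrow> 'c::heine_borel"
  assumes "bounded_continuous_on S u" "bounded_continuous_on S v" "continuous_on UNIV (\<lambda>p. H (fst p) (snd p))"
  shows "bounded_continuous_on S (\<lambda>x. H (u x) (v x))"
  using bounded_continuous_on_compose[OF bounded_continuous_on_Pair[OF assms(1,2)] assms(3)] by simp

lemma bounded_continuous_on_add:
  fixes u v :: "'a::topological_space \<Rightarrow> real"
  assumes "bounded_continuous_on S u" "bounded_continuous_on S v"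
  shows "bounded_continuous_on S (\<lambda>x. u x + v x)"
  by (rule bounded_continuous_on_compose_Pair[OF assms, of "(+)"]) (intro continuous_intros)

lemma bounded_continuous_on_mult:
  fixes u v :: "'a::topological_space \<Rightarrow> real"
  assumes "bounded_continuous_on S u" "bounded_continuous_on S v"
  shows "bounded_continuous_on S (\<lambda>x. u x * v x)"
  by (rule bounded_continuous_on_compose_Pair[OF assms, of "(*)"]) (intro continuous_intros)

lemma bounded_continuous_on_inner:
  fixes u v :: "'a::topological_space \<Rightarrow> 'b::euclidean_space"
  assumes "bounded_continuous_on S u" "bounded_continuous_on S v"
  shows "bounded_continuous_on S (\<lambda>x. u x \<bullet> v x)"
  by (rule bounded_continuous_on_compose_Pair[OF assms, of "(\<bullet>)"]) (intro continuous_intros)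

lemma uniformly_continuous_on_compose_bounded:
  fixes u :: "'a::metric_space \<Rightarrow> 'b::heine_borel" and H :: "'b \<Rightarrow> 'c::metric_space"
  assumes "uniformly_continuous_on S u" "bounded (u ` S)" "continuous_on UNIV H"
  shows "uniformly_continuous_on S (\<lambda>x. H (u x))"
proof -
  have "uniformly_continuous_on (closure (u ` S)) H"
    using assms(2,3) by (intro compact_uniformly_continuous) (auto intro: continuous_on_subset)
  then have "uniformly_continuous_on (u ` S) H"
    unfolding uniformly_continuous_on_def using closure_subset[of "u ` S"] by (meson subsetD)
  then show ?thesis
    using assms(1) uniformly_continuous_on_compose by blast
qed

text \<open>Products of uniformly continuous functions can fail to be uniformly continuous. On a
  bounded \<open>S\<close> the pair has relatively compact range, and \<open>H\<close> is uniformly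
  continuous on the closure of that range.\<close>

lemma uniformly_continuous_on_bilinear:
  fixes u :: "'a::heine_borel \<Rightarrow> 'b::euclidean_space" and v :: "'a \<Rightarrow> 'c::euclidean_space"
    and H :: "'b \<Rightarrow> 'c \<Rightarrow> 'd::real_normed_vector"
  assumes "bounded S" "uniformly_continuous_on S u" "uniformly_continuous_on S v" "bounded_bilinear H"
  shows "uniformly_continuous_on S (\<lambda>x. H (u x) (v x))"
proof -
  have "continuous_on UNIV (\<lambda>p. H (fst p) (snd p))"
    by (intro bounded_bilinear.continuous_on[OF assms(4)] continuous_intros)
  moreover have "bounded ((\<lambda>x. (u x, v x)) ` S)"
    using bounded_continuous_on_Pair[OF bounded_continuous_on_uniform[OF assms(1,2)]
        bounded_continuous_on_uniform[OF assms(1,3)]]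
    by (simp add: bounded_continuous_on_def)
  moreover have "uniformly_continuous_on S (\<lambda>x. (u x, v x))"
  unfolding uniformly_continuous_on_def
  proof (intro allI impI)
    fix e :: real assume "e > 0"
    then have e: "e / 2 > 0" by simp
    obtain d1 where d1: "d1 > 0" "\<And>x y. x \<in> S \<Longrightarrow> y \<in> S \<Longrightarrow> dist y x < d1 \<Longrightarrow> dist (u y) (u x) < e / 2"
      using uniformly_continuous_onE[OF assms(2) e] by metis
    obtain d2 where d2: "d2 > 0" "\<And>x y. x \<in> S \<Longrightarrow> y \<in> S \<Longrightarrow> dist y x < d2 \<Longrightarrow> dist (v y) (v x) < e / 2"
      using uniformly_continuous_onE[OF assms(3) e] by metis
    have "dist (u y, v y) (u x, v x) < e"
      if "x \<in> S" "y \<in> S" "dist y x < min d1 d2" for x y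
    proof -
      have "dist (u y, v y) (u x, v x) \<le> dist (u y) (u x) + dist (v y) (v x)"
        by (simp add: dist_prod_def sqrt_sum_squares_le_sum)
      also have "\<dots> < e"
        using d1(2)[of x y] d2(2)[of x y] that by simp
      finally show ?thesis .
    qed
    then show "\<exists>d>0. \<forall>x\<in>S. \<forall>x'\<in>S. dist x' x < d \<longrightarrow> dist (u x', v x') (u x, v x) < e"
      using d1(1) d2(1) by (intro exI[of _ "min d1 d2"]) auto
  qed
  ultimately show ?thesis
    using uniformly_continuous_on_compose_bounded[of S "\<lambda>x. (u x, v x)" "\<lambda>p. H (fst p) (snd p)"] by simp
qed

lemma set_integrable_bounded_continuous_on:
  fixes u :: "'a::topological_space \<Rightarrow> 'b::euclidean_space"
  assumes "sets M = sets borel" "S \<in> sets borel" "emeasure M S < \<infinity>" "bounded_continuous_on S u"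
  shows "set_integrable M S u"
proof -
  obtain B where B: "\<And>x. x \<in> S \<Longrightarrow> norm (u x) \<le> B"
    using assms(4) by (auto simp: bounded_continuous_on_def bounded_iff)
  have "(\<lambda>x. indicator S x *\<^sub>R u x) \<in> borel_measurable borel"
    using assms(2,4) by (intro borel_measurable_continuous_on_indicator) (auto simp: bounded_continuous_on_def)
  then have "(\<lambda>x. indicator S x *\<^sub>R u x) \<in> borel_measurable M"
    using assms(1) measurable_cong_sets by blast
  then show ?thesis
    unfolding set_integrable_def
    using assms(1-3) B
    by (intro integrableI_bounded_set[where A=S and B=B]) (auto simp: indicator_def)
qed

lemma set_integral_const:
  fixes c :: real
  assumes "S \<in> sets M" "emeasure M S < \<infinity>"
  shows "(LINT x:S|M. c) = measure M S * c"
  using has_bochner_integral_integral_eq[OF has_bochner_integral_indicator[OF assms, of c]]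
  by (simp add: set_lebesgue_integral_def)

text \<open>With \<open>c\<close> the mean, write \<open>u = (u - c) + c\<close>: the constant part
  is orthogonal to \<open>u - c\<close>, so the integral equals that of
  \<open>(u - c)\<^sup>2\<close>.\<close>

lemma integral_mean_free_nonneg:
  fixes u :: "'a::topological_space \<Rightarrow> real"
  assumes "sets M = sets borel" "S \<in> sets borel" "emeasure M S < \<infinity>" "bounded_continuous_on S u"
  shows "0 \<le> (LINT x:S|M. u x * mean_free M S u x)"
proof -
  note int = set_integrable_bounded_continuous_on[OF assms(1-3)]
  define I where "I = (LINT y:S|M. u y)"
  define c where "c = 1 / measure M S * I"
  have m: "(LINT x:S|M. a) = measure M S * a" for a :: real
    using assms(1-3) by (intro set_integral_const) auto
  have sq: "bounded_continuous_on S (\<lambda>x. (u x - c)\<^sup>2)"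
    by (rule bounded_continuous_on_compose[OF assms(4)]) (intro continuous_intros)
  have "(LINT x:S|M. u x * mean_free M S u x) = (LINT x:S|M. (u x - c)\<^sup>2 + c * (u x - c))"
    by (intro arg_cong[where f="set_lebesgue_integral M S"] ext)
      (simp add: mean_free_def c_def I_def power2_eq_square algebra_simps)
  also have "\<dots> = (LINT x:S|M. (u x - c)\<^sup>2) + (LINT x:S|M. c * (u x - c))"
    by (intro set_integral_add int sq bounded_continuous_on_mult bounded_continuous_on_const
        bounded_continuous_on_compose[OF assms(4)] continuous_intros)
  also have "(LINT x:S|M. c * (u x - c)) = c * (I - measure M S * c)"
    using set_integral_diff(2)[OF int[OF assms(4)] int[OF bounded_continuous_on_const[of S c]]] m
    by (simp add: I_def)
  \<comment> \<open>For positive measure the bracket vanishes by the choice of \<open>c\<close>; for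
    measure 0 the convention \<open>1 / 0 = 0\<close> gives \<open>c = 0\<close>.\<close>
  also have "\<dots> = 0"
    by (simp add: c_def)
  finally have "(LINT x:S|M. u x * mean_free M S u x) = (LINT x:S|M. (u x - c)\<^sup>2)"
    by simp
  moreover have "0 \<le> (LINT x:S|M. (u x - c)\<^sup>2)"
    unfolding set_lebesgue_integral_def by (intro integral_nonneg_AE) auto
  ultimately show ?thesis by simp
qed

text \<open>\<open>measure_of\<close> takes its sigma-algebra from the generator alone, whatever the
  set function, and the Borel sets generate themselves.\<close>

lemma sets_surface_measure: "sets surface_measure = sets borel"
  using sets.sigma_sets_eq[of borel]
  by (simp add: surface_measure_def hausdorff_measure_def)

section \<open>Time derivatives that are uniform in space\<close>

text \<open>The neighbourhood of \<open>t\<close> is chosen before the point \<open>x\<close>. This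
  order of quantifiers is what allows integrating the remainder, letting \<open>x\<close> tend to
  the boundary, and exchanging the time limit with a spatial derivative.\<close>

definition has_uniform_derivative ::
  "'a set \<Rightarrow> (real \<Rightarrow> 'a \<Rightarrow> 'b::real_normed_vector) \<Rightarrow> ('a \<Rightarrow> 'b) \<Rightarrow> real \<Rightarrow> bool" where
  "has_uniform_derivative S u D t \<longleftrightarrow>
     (\<forall>e>0. \<forall>\<^sub>F s in at t. \<forall>x\<in>S. norm (u s x - u t x - (s - t) *\<^sub>R D x) \<le> e * \<bar>s - t\<bar>)"

lemma has_uniform_derivative_imp_has_vector_derivative:
  assumes "has_uniform_derivative S u D t" "x \<in> S"
  shows "((\<lambda>s. u s x) has_vector_derivative D x) (at t)"
  unfolding has_vector_derivative_def has_derivative_within_alt2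
proof (intro conjI allI impI)
  show "bounded_linear (\<lambda>h. h *\<^sub>R D x)" by (rule bounded_linear_scaleR_left)
  fix e :: real assume "e > 0"
  then show "\<forall>\<^sub>F s in at t. norm (u s x - u t x - (s - t) *\<^sub>R D x) \<le> e * norm (s - t)"
    using assms unfolding has_uniform_derivative_def by (auto elim!: allE[of _ e] eventually_mono)
qed

text \<open>For each \<open>x\<close> the mean value inequality bounds the remainder by the
  oscillation of the time derivative between \<open>t\<close> and \<open>s\<close>; uniform
  continuity on a time slab makes that oscillation small independently of \<open>x\<close>.\<close>

lemma time_C1_has_uniform_derivative:
  assumes "time_C1 T S u" "t \<in> {0<..<T}"
  shows "has_uniform_derivative S u (\<lambda>x. vector_derivative (\<lambda>s. u s x) (at t)) t"
  unfolding has_uniform_derivative_def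
proof (intro allI impI)
  fix e :: real assume "e > 0"
  define D where "D = (\<lambda>s x. vector_derivative (\<lambda>s. u s x) (at s))"
  \<comment> \<open>Midpoints, so that \<open>{a..b}\<close> contains \<open>t\<close> in its
    interior and stays inside (0,T); \<open>time_C1\<close> gives uniform continuity only on such
    closed subintervals.\<close>
  define a b where "a = t / 2" and "b = (t + T) / 2"
  have ab: "0 < a" "a < t" "t < b" "b < T"
    using assms(2) by (auto simp: a_def b_def)
  have "uniformly_continuous_on ({a..b} \<times> S) (\<lambda>(t, x). D t x)"
    using assms(1) ab by (simp add: time_C1_def D_def)
  then obtain d where d: "d > 0"
    "\<And>p q. p \<in> {a..b} \<times> S \<Longrightarrow> q \<in> {a..b} \<times> S \<Longrightarrow> dist q p < d \<Longrightarrow>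
      dist ((\<lambda>(t, x). D t x) q) ((\<lambda>(t, x). D t x) p) < e"
    using \<open>e > 0\<close> unfolding uniformly_continuous_on_def by metis
  have "\<forall>\<^sub>F s in at t. s \<in> {a<..<b} \<and> dist s t < d"
    using ab d(1) by (intro eventually_conj eventually_at_in_open') (auto simp: eventually_at)
  then show "\<forall>\<^sub>F s in at t. \<forall>x\<in>S.
      norm (u s x - u t x - (s - t) *\<^sub>R vector_derivative (\<lambda>s. u s x) (at t)) \<le> e * \<bar>s - t\<bar>"
  proof eventually_elim
    case (elim s)
    have seg: "closed_segment t s \<subseteq> {a..b}"
      using elim ab by (auto simp: closed_segment_eq_real_ivl)
    have "norm (u s x - u t x - (s - t) *\<^sub>R D t x) \<le> norm (s - t) * e" if "x \<in> S" for x
    proof (rule vector_differentiable_bound_linearization[where S="closed_segment t s" and ?x0.0=t])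
      fix r assume r: "r \<in> closed_segment t s"
      then have r': "r \<in> {a..b}" "\<bar>r - t\<bar> < d"
        using seg elim segment_bound1[OF r] by (auto simp: dist_real_def)
      then have "(\<lambda>s. u s x) differentiable (at r)"
        using assms(1) ab that by (auto simp: time_C1_def)
      then show "((\<lambda>s. u s x) has_vector_derivative D r x) (at r within closed_segment t s)"
        unfolding D_def by (meson has_vector_derivative_at_within vector_derivative_works)
      show "norm (D r x - D t x) \<le> e"
        using d(2)[of "(t, x)" "(r, x)"] r' that ab by (auto simp: dist_norm dist_Pair_Pair norm_minus_commute)
    qed auto
    then show ?case
      by (auto simp: D_def mult.commute)
  qed
qed

lemma time_C1_uniformly_continuous:
  assumes "time_C1 T S u" "t \<in> {0<..<T}"
  shows "uniformly_continuous_on S (\<lambda>x. vector_derivative (\<lambda>s. u s x) (at t))"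
proof -
  have "uniformly_continuous_on ({t..t} \<times> S) (\<lambda>(t, x). vector_derivative (\<lambda>s. u s x) (at t))"
    using assms unfolding time_C1_def greaterThanLessThan_iff by blast
  then show ?thesis
    unfolding uniformly_continuous_on_def by (simp add: dist_Pair_Pair)
qed

lemma has_uniform_derivative_cong:
  assumes "\<And>x. x \<in> S \<Longrightarrow> D x = D' x"
  shows "has_uniform_derivative S u D t \<longleftrightarrow> has_uniform_derivative S u D' t"
  unfolding has_uniform_derivative_def using assms by simp

lemma has_uniform_derivative_cmult_add:
  fixes u v :: "real \<Rightarrow> 'a \<Rightarrow> real"
  assumes "has_uniform_derivative S u D t" "has_uniform_derivative S v E t"
  shows "has_uniform_derivative S (\<lambda>s x. c * u s x + v s x) (\<lambda>x. c * D x + E x) t"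
  unfolding has_uniform_derivative_def
proof (intro allI impI)
  fix e :: real assume e: "e > 0"
  define e' where "e' = e / (\<bar>c\<bar> + 1)"
  have e': "e' > 0" "(\<bar>c\<bar> + 1) * e' = e"
    using e by (auto simp: e'_def add_nonneg_pos)
  have "\<forall>\<^sub>F s in at t. (\<forall>x\<in>S. norm (u s x - u t x - (s - t) *\<^sub>R D x) \<le> e' * \<bar>s - t\<bar>)
      \<and> (\<forall>x\<in>S. norm (v s x - v t x - (s - t) *\<^sub>R E x) \<le> e' * \<bar>s - t\<bar>)"
    using assms e'(1) unfolding has_uniform_derivative_def by (intro eventually_conj) auto
  then show "\<forall>\<^sub>F s in at t. \<forall>x\<in>S. norm (c * u s x + v s x - (c * u t x + v t x)
      - (s - t) *\<^sub>R (c * D x + E x)) \<le> e * \<bar>s - t\<bar>"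
  proof (rule eventually_mono, intro ballI, goal_cases)
    case (1 s x)
    let ?p = "u s x - u t x - (s - t) * D x" and ?q = "v s x - v t x - (s - t) * E x"
    have "norm (c * u s x + v s x - (c * u t x + v t x) - (s - t) *\<^sub>R (c * D x + E x)) = \<bar>c * ?p + ?q\<bar>"
      by (simp add: algebra_simps)
    also have "\<dots> \<le> \<bar>c\<bar> * \<bar>?p\<bar> + \<bar>?q\<bar>"
      by (metis abs_mult abs_triangle_ineq)
    also have "\<dots> \<le> \<bar>c\<bar> * (e' * \<bar>s - t\<bar>) + e' * \<bar>s - t\<bar>"
      using 1 by (intro add_mono mult_left_mono) auto
    also have "\<dots> = (\<bar>c\<bar> + 1) * e' * \<bar>s - t\<bar>"
      by (simp add: algebra_simps)
    finally show ?case by (simp add: e'(2))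
  qed
qed

text \<open>The mean value inequality for \<open>u z - z \<bullet> A\<close>, whose gradient is
  \<open>g z - A\<close>. The vector \<open>A\<close> is arbitrary because later it is a limit of
  gradients, or a gradient at a point off the segment.\<close>

lemma gradient_mean_value:
  fixes u :: "'a::euclidean_space \<Rightarrow> real"
  assumes "\<And>z. z \<in> closed_segment a b \<Longrightarrow> (u has_derivative (\<lambda>h. h \<bullet> g z)) (at z)"
    and "\<And>z. z \<in> closed_segment a b \<Longrightarrow> norm (g z - A) \<le> e"
  shows "\<bar>u b - u a - (b - a) \<bullet> A\<bar> \<le> e * norm (b - a)"
proof -
  have "norm ((\<lambda>z. u z - z \<bullet> A) b - (\<lambda>z. u z - z \<bullet> A) a) \<le> e * norm (b - a)"
  proof (rule differentiable_bound[where S="closed_segment a b" and f'="\<lambda>z h. h \<bullet> g z - h \<bullet> A"])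
    fix z assume z: "z \<in> closed_segment a b"
    show "((\<lambda>z. u z - z \<bullet> A) has_derivative (\<lambda>h. h \<bullet> g z - h \<bullet> A)) (at z within closed_segment a b)"
      using has_derivative_at_withinI[OF assms(1)[OF z]] by (auto intro!: derivative_eq_intros)
    show "onorm (\<lambda>h. h \<bullet> g z - h \<bullet> A) \<le> e"
    proof (rule onorm_le)
      fix h
      have "norm (h \<bullet> g z - h \<bullet> A) \<le> norm h * norm (g z - A)"
        using Cauchy_Schwarz_ineq2[of h "g z - A"] by (simp add: inner_diff_right)
      also have "\<dots> \<le> e * norm h"
        using mult_left_mono[OF assms(2)[OF z] norm_ge_zero[of h]] by (simp add: mult.commute)
      finally show "norm (h \<bullet> g z - h \<bullet> A) \<le> e * norm h" .
    qed
  qed auto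
  then show ?thesis by (simp add: algebra_simps inner_diff_left)
qed

text \<open>A chain rule uniform in \<open>x\<close>, although \<open>g\<close> is only continuous:
  since \<open>u t\<close> has bounded range, for \<open>s\<close> near \<open>t\<close> all
  segments from \<open>u t x\<close> to \<open>u s x\<close> lie in one compact ball, where
  \<open>g\<close> is bounded and uniformly continuous.\<close>

lemma has_uniform_derivative_compose:
  fixes u :: "real \<Rightarrow> 'a \<Rightarrow> 'b::euclidean_space" and H :: "'b \<Rightarrow> real"
  assumes u: "has_uniform_derivative S u D t" "bounded (u t ` S)" "bounded (D ` S)"
    and H: "\<And>y. (H has_derivative (\<lambda>h. h \<bullet> g y)) (at y)" "continuous_on UNIV g"
  shows "has_uniform_derivative S (\<lambda>s x. H (u s x)) (\<lambda>x. D x \<bullet> g (u t x)) t"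
  unfolding has_uniform_derivative_def
proof (intro allI impI)
  fix e :: real assume e: "e > 0"
  obtain R where R: "\<And>x. x \<in> S \<Longrightarrow> norm (u t x) \<le> R"
    using u(2) by (auto simp: bounded_iff)
  obtain B where B: "B > 0" "\<And>x. x \<in> S \<Longrightarrow> norm (D x) \<le> B"
    using u(3) by (auto simp: bounded_pos)
  have cont: "continuous_on (cball 0 (R + 1)) g"
    using H(2) continuous_on_subset by blast
  obtain M where M: "M > 0" "\<And>y. y \<in> cball 0 (R + 1) \<Longrightarrow> norm (g y) \<le> M"
    using compact_imp_bounded[OF compact_continuous_image[OF cont compact_cball]]
    by (auto simp: bounded_pos)
  \<comment> \<open>The error splits in two halves: \<open>e1\<close> bounds the oscillation of
    \<open>g\<close> and gets multiplied by the increment of \<open>u\<close>, at most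
    \<open>(B + 1) * \<bar>s - t\<bar>\<close>; \<open>e2\<close> bounds the remainder of
    \<open>u\<close> and gets multiplied by \<open>norm (g (u t x)) \<le> M\<close>. The cap
    \<open>e2 \<le> 1\<close> yields the summand 1 in \<open>B + 1\<close>.\<close>
  define e1 e2 where "e1 = e / (2 * (B + 1))" and "e2 = min 1 (e / (2 * M))"
  have e12: "e1 > 0" "e2 > 0" "e2 \<le> 1" "(B + 1) * e1 = e / 2" "e2 * M \<le> e / 2"
  proof -
    have "e2 * M \<le> (e / (2 * M)) * M"
      using M(1) by (intro mult_right_mono) (auto simp: e2_def)
    then show "e2 * M \<le> e / 2" using M(1) by simp
  qed (use e B(1) M(1) in \<open>auto simp: e1_def e2_def field_simps\<close>)
  obtain d where d: "d > 0"
    "\<And>y z. y \<in> cball 0 (R + 1) \<Longrightarrow> z \<in> cball 0 (R + 1) \<Longrightarrow> dist z y < d \<Longrightarrow> dist (g z) (g y) < e1"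
    using compact_uniformly_continuous[OF cont compact_cball] e12(1)
    unfolding uniformly_continuous_on_def by metis
  \<comment> \<open>For \<open>\<bar>s - t\<bar> < r\<close> the increment of \<open>u\<close> is
    below 1, hence inside the larger ball, and below the modulus \<open>d\<close>.\<close>
  define r where "r = min 1 d / (B + 1)"
  have r: "r > 0" "(B + 1) * r = min 1 d"
    using d(1) B(1) by (auto simp: r_def)
  have "\<forall>\<^sub>F s in at t. \<bar>s - t\<bar> < r"
    using r(1) by (auto simp: eventually_at dist_real_def)
  moreover have "\<forall>\<^sub>F s in at t. \<forall>x\<in>S. norm (u s x - u t x - (s - t) *\<^sub>R D x) \<le> e2 * \<bar>s - t\<bar>"
    using u(1) e12(2) unfolding has_uniform_derivative_def by blast
  ultimately have "\<forall>\<^sub>F s in at t. \<bar>s - t\<bar> < r \<and>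
      (\<forall>x\<in>S. norm (u s x - u t x - (s - t) *\<^sub>R D x) \<le> e2 * \<bar>s - t\<bar>)"
    by eventually_elim simp
  then show "\<forall>\<^sub>F s in at t. \<forall>x\<in>S. norm (H (u s x) - H (u t x) - (s - t) *\<^sub>R (D x \<bullet> g (u t x)))
      \<le> e * \<bar>s - t\<bar>"
  proof (rule eventually_mono, intro ballI, goal_cases)
    case (1 s x)
    then have elim: "\<bar>s - t\<bar> < r"
      "norm (u s x - u t x - (s - t) *\<^sub>R D x) \<le> e2 * \<bar>s - t\<bar>" "x \<in> S"
      by auto
    define h where "h = u s x - u t x"
    have p: "norm (h - (s - t) *\<^sub>R D x) \<le> e2 * \<bar>s - t\<bar>"
      using elim by (simp add: h_def)
    have "norm h \<le> norm (h - (s - t) *\<^sub>R D x) + norm ((s - t) *\<^sub>R D x)"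
      by (metis diff_add_cancel norm_triangle_ineq)
    also have "\<dots> \<le> 1 * \<bar>s - t\<bar> + \<bar>s - t\<bar> * B"
      using order_trans[OF p mult_right_mono[OF e12(3)]] mult_left_mono[OF B(2)[OF elim(3)]]
      by (intro add_mono) auto
    finally have h: "norm h \<le> (B + 1) * \<bar>s - t\<bar>"
      by (simp add: algebra_simps)
    also have "\<dots> < (B + 1) * r"
      using elim(1) B(1) by (intro mult_strict_left_mono) auto
    finally have h1: "norm h < 1" "norm h < d"
      by (auto simp: r(2))
    have seg: "z \<in> cball 0 (R + 1) \<and> dist z (u t x) < d" if "z \<in> closed_segment (u t x) (u s x)" for z
    proof -
      have *: "dist z (u t x) \<le> norm h"
        using segment_bound1[OF that] by (simp add: h_def dist_norm)
      moreover have "norm z \<le> norm (u t x) + dist z (u t x)"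
        by (metis dist_norm norm_triangle_sub)
      ultimately show ?thesis using h1 R[OF elim(3)] by auto
    qed
    have ut: "u t x \<in> cball 0 (R + 1)"
      using R[OF elim(3)] by simp
    have "\<bar>H (u s x) - H (u t x) - (u s x - u t x) \<bullet> g (u t x)\<bar> \<le> e1 * norm (u s x - u t x)"
      using seg ut d(2)[OF ut]
      by (intro gradient_mean_value[where g=g]) (auto intro!: H(1) less_imp_le simp: dist_norm)
    also have "\<dots> \<le> e1 * ((B + 1) * \<bar>s - t\<bar>)"
      using h e12(1) by (intro mult_left_mono) (auto simp: h_def)
    also have "\<dots> = e / 2 * \<bar>s - t\<bar>"
      using e12(4) by (metis mult.assoc mult.commute)
    finally have 1: "\<bar>H (u s x) - H (u t x) - h \<bullet> g (u t x)\<bar> \<le> e / 2 * \<bar>s - t\<bar>"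
      by (simp add: h_def)
    have "\<bar>(h - (s - t) *\<^sub>R D x) \<bullet> g (u t x)\<bar> \<le> norm (h - (s - t) *\<^sub>R D x) * norm (g (u t x))"
      by (rule Cauchy_Schwarz_ineq2)
    also have "\<dots> \<le> (e2 * \<bar>s - t\<bar>) * M"
      using p M(2)[OF ut] e12(2) by (intro mult_mono) auto
    also have "\<dots> = (e2 * M) * \<bar>s - t\<bar>"
      by simp
    also have "\<dots> \<le> e / 2 * \<bar>s - t\<bar>"
      using e12(5) by (intro mult_right_mono) auto
    finally have 2: "\<bar>h \<bullet> g (u t x) - (s - t) * (D x \<bullet> g (u t x))\<bar> \<le> e / 2 * \<bar>s - t\<bar>"
      by (simp add: inner_diff_left)
    have "e / 2 * \<bar>s - t\<bar> + e / 2 * \<bar>s - t\<bar> = e * \<bar>s - t\<bar>"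
      by (simp add: field_simps)
    then show ?case using 1 2 unfolding real_norm_def real_scaleR_def by linarith
  qed
qed

text \<open>Differentiation under the integral without dominated convergence: on a set of finite
  measure, integrating the uniform remainder costs only the factor
  \<open>measure M S\<close>.\<close>

lemma has_derivative_set_integral:
  fixes u :: "real \<Rightarrow> 'a::topological_space \<Rightarrow> real"
  assumes M: "sets M = sets borel" "S \<in> sets borel" "emeasure M S < \<infinity>"
    and u: "\<forall>\<^sub>F s in at t. bounded_continuous_on S (u s)" "bounded_continuous_on S (u t)"
      "bounded_continuous_on S D" "has_uniform_derivative S u D t"
  shows "((\<lambda>s. LINT x:S|M. u s x) has_real_derivative (LINT x:S|M. D x)) (at t)"
  unfolding has_field_derivative_def has_derivative_within_alt2
proof (intro conjI allI impI)
  note int = set_integrable_bounded_continuous_on[OF M]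
  show "bounded_linear ((*) (LINT x:S|M. D x))"
    by (rule bounded_linear_mult_right)
  fix e :: real assume e: "e > 0"
  define m where "m = measure M S"
  have m: "m \<ge> 0" by (simp add: m_def)
  define e' where "e' = e / (m + 1)"
  have e': "e' > 0" using e m by (simp add: e'_def)
  have "e' * m \<le> e' * (m + 1)"
    using e' by simp
  then have e'm: "e' * m \<le> e"
    using m by (simp add: e'_def)
  have "\<forall>\<^sub>F s in at t. \<forall>x\<in>S. norm (u s x - u t x - (s - t) *\<^sub>R D x) \<le> e' * \<bar>s - t\<bar>"
    using u(4) e' unfolding has_uniform_derivative_def by blast
  with u(1) show "\<forall>\<^sub>F s in at t. norm ((LINT x:S|M. u s x) - (LINT x:S|M. u t x) - (LINT x:S|M. D x) * (s - t))
      \<le> e * norm (s - t)"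
  proof eventually_elim
    case (elim s)
    define w where "w x = u s x - u t x - (s - t) * D x" for x
    have wi: "set_integrable M S w" unfolding w_def
      by (intro set_integral_diff(1) set_integrable_mult_right int elim(1) u)
    have "(LINT x:S|M. w x) = (LINT x:S|M. u s x) - (LINT x:S|M. u t x) - (s - t) * (LINT x:S|M. D x)"
      unfolding w_def
      by (subst set_integral_diff(2), intro set_integral_diff int elim(1) u,
          intro set_integrable_mult_right int u, subst set_integral_diff(2), intro int elim(1), intro int u, simp)
    moreover have "\<bar>LINT x:S|M. w x\<bar> \<le> (LINT x:S|M. e' * \<bar>s - t\<bar>)"
    proof -
      have "\<bar>LINT x:S|M. w x\<bar> \<le> (LINT x:S|M. \<bar>w x\<bar>)"
        using integral_abs_bound[of M "\<lambda>x. indicator S x * w x"]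
        by (simp add: set_lebesgue_integral_def abs_mult)
      also have "\<dots> \<le> (LINT x:S|M. e' * \<bar>s - t\<bar>)"
        using elim(2)
        by (intro set_integral_mono set_integrable_abs[OF wi] int bounded_continuous_on_const)
          (auto simp: w_def)
      finally show ?thesis .
    qed
    moreover have "(LINT x:S|M. e' * \<bar>s - t\<bar>) = (e' * m) * \<bar>s - t\<bar>"
      using M by (subst set_integral_const) (auto simp: m_def)
    moreover have "(e' * m) * \<bar>s - t\<bar> \<le> e * \<bar>s - t\<bar>"
      using e'm by (intro mult_right_mono) auto
    ultimately show ?case unfolding real_norm_def by (metis mult.commute order_trans)
  qed
qed

text \<open>The measure, the field \<open>v\<close> and the potential \<open>H\<close> are left
  abstract so that one computation covers both halves of the energy: gradients with
  \<open>double_well\<close> on \<Omega>, tangential gradients with \<open>G\<close> on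
  \<Gamma>.\<close>

lemma has_derivative_energy:
  fixes u :: "real \<Rightarrow> 'a::topological_space \<Rightarrow> real" and v :: "real \<Rightarrow> 'a \<Rightarrow> 'b::euclidean_space"
  assumes M: "sets M = sets borel" "S \<in> sets borel" "emeasure M S < \<infinity>"
    and t: "t \<in> {a<..<b}"
    and u: "\<And>s. s \<in> {a<..<b} \<Longrightarrow> bounded_continuous_on S (u s)" "bounded_continuous_on S D"
      "has_uniform_derivative S u D t"
    and v: "\<And>s. s \<in> {a<..<b} \<Longrightarrow> bounded_continuous_on S (v s)" "bounded_continuous_on S E"
      "has_uniform_derivative S v E t"
    and H: "\<And>y. (H has_real_derivative h y) (at y)" "continuous_on UNIV h"
  shows "((\<lambda>s. LINT x:S|M. c\<^sup>2 / 2 * (norm (v s x))\<^sup>2 + H (u s x)) has_real_derivative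
     c\<^sup>2 * (LINT x:S|M. E x \<bullet> v t x) + (LINT x:S|M. D x * h (u t x))) (at t)"
proof -
  note int = set_integrable_bounded_continuous_on[OF M]
  have Hc: "continuous_on UNIV H"
    using H(1) by (meson DERIV_continuous_on has_field_derivative_at_within)
  have bc: "bounded_continuous_on S (\<lambda>x. c\<^sup>2 / 2 * (norm (v s x))\<^sup>2 + H (u s x))"
    if "s \<in> {a<..<b}" for s
    by (intro bounded_continuous_on_add bounded_continuous_on_compose[OF v(1)[OF that]]
        bounded_continuous_on_compose[OF u(1)[OF that]] Hc continuous_intros)
  have "((\<lambda>s. LINT x:S|M. c\<^sup>2 / 2 * (norm (v s x))\<^sup>2 + H (u s x)) has_real_derivative
     (LINT x:S|M. c\<^sup>2 / 2 * (E x \<bullet> (2 *\<^sub>R v t x)) + D x \<bullet> h (u t x))) (at t)"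
  proof (rule has_derivative_set_integral[OF M])
    show "\<forall>\<^sub>F s in at t. bounded_continuous_on S (\<lambda>x. c\<^sup>2 / 2 * (norm (v s x))\<^sup>2 + H (u s x))"
      using bc eventually_at_in_open'[of "{a<..<b}" t] t by (auto elim!: eventually_mono)
    show "bounded_continuous_on S (\<lambda>x. c\<^sup>2 / 2 * (norm (v t x))\<^sup>2 + H (u t x))"
      by (rule bc[OF t])
    have "bounded_continuous_on S (\<lambda>x. (c\<^sup>2 / 2) * (E x \<bullet> (2 *\<^sub>R v t x)) + D x * h (u t x))"
      by (intro bounded_continuous_on_add bounded_continuous_on_mult bounded_continuous_on_inner u v
          bounded_continuous_on_const bounded_continuous_on_compose[OF u(1)[OF t]]
          bounded_continuous_on_compose[OF v(1)[OF t]] H continuous_intros)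
    then show "bounded_continuous_on S (\<lambda>x. c\<^sup>2 / 2 * (E x \<bullet> (2 *\<^sub>R v t x)) + D x \<bullet> h (u t x))"
      by simp
    show "has_uniform_derivative S (\<lambda>s x. c\<^sup>2 / 2 * (norm (v s x))\<^sup>2 + H (u s x))
        (\<lambda>x. c\<^sup>2 / 2 * (E x \<bullet> (2 *\<^sub>R v t x)) + D x \<bullet> h (u t x)) t"
    proof (intro has_uniform_derivative_cmult_add)
      show "has_uniform_derivative S (\<lambda>s x. (norm (v s x))\<^sup>2) (\<lambda>x. E x \<bullet> (2 *\<^sub>R v t x)) t"
      proof (rule has_uniform_derivative_compose[OF v(3)])
        show "((\<lambda>y::'b. (norm y)\<^sup>2) has_derivative (\<lambda>h. h \<bullet> (2 *\<^sub>R y))) (at y)" for y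
          unfolding power2_norm_eq_inner
          by (auto intro!: derivative_eq_intros simp: inner_commute)
      qed (use v(1)[OF t] v(2) in \<open>auto simp: bounded_continuous_on_def intro: continuous_intros\<close>)
      show "has_uniform_derivative S (\<lambda>s x. H (u s x)) (\<lambda>x. D x \<bullet> h (u t x)) t"
        by (rule has_uniform_derivative_compose[OF u(3)])
          (use u(1)[OF t] u(2) H in \<open>auto simp: bounded_continuous_on_def has_field_derivative_def mult.commute[of _ "h _"]\<close>)
    qed
  qed
  also have "(LINT x:S|M. c\<^sup>2 / 2 * (E x \<bullet> (2 *\<^sub>R v t x)) + D x \<bullet> h (u t x)) =
      (LINT x:S|M. c\<^sup>2 * (E x \<bullet> v t x) + D x * h (u t x))"
    by simp
  also have "\<dots> = (LINT x:S|M. c\<^sup>2 * (E x \<bullet> v t x)) + (LINT x:S|M. D x * h (u t x))"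
    by (intro set_integral_add int set_integrable_mult_right bounded_continuous_on_mult
        bounded_continuous_on_inner u v t H bounded_continuous_on_compose[OF u(1)[OF t]])
  finally show ?thesis by simp
qed

lemma has_uniform_derivative_quotient:
  assumes "has_uniform_derivative S u D t" "e > 0"
  shows "\<forall>\<^sub>F s in at t. \<forall>x\<in>S. norm ((u s x - u t x) /\<^sub>R (s - t) - D x) \<le> e"
proof -
  have "\<forall>\<^sub>F s in at t. s \<noteq> t \<and> (\<forall>x\<in>S. norm (u s x - u t x - (s - t) *\<^sub>R D x) \<le> e * \<bar>s - t\<bar>)"
    using assms by (intro eventually_conj eventually_neq_at_within) (auto simp: has_uniform_derivative_def)
  then show ?thesis
  proof (rule eventually_mono, intro ballI, goal_cases)
    case (1 s x)
    then have st: "s \<noteq> t" and le: "norm (u s x - u t x - (s - t) *\<^sub>R D x) \<le> e * \<bar>s - t\<bar>"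
      by auto
    have "(u s x - u t x) /\<^sub>R (s - t) - D x = (u s x - u t x - (s - t) *\<^sub>R D x) /\<^sub>R (s - t)"
      using st by (simp add: scaleR_diff_right)
    then have "norm ((u s x - u t x) /\<^sub>R (s - t) - D x) = norm (u s x - u t x - (s - t) *\<^sub>R D x) / \<bar>s - t\<bar>"
      by (simp add: divide_inverse mult.commute)
    then show ?case
      using le st by (simp add: divide_le_eq)
  qed
qed

text \<open>Difference quotients stay in \<open>Z\<close>, and a subspace of a Euclidean space is
  closed.\<close>

lemma has_vector_derivative_mem_subspace:
  fixes f :: "real \<Rightarrow> 'a::euclidean_space"
  assumes "subspace Z" "\<forall>\<^sub>F s in at t. f s \<in> Z" "f t \<in> Z" "(f has_vector_derivative f') (at t)"
  shows "f' \<in> Z"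
proof -
  \<comment> \<open>Over a one-point set a uniform derivative is an ordinary one, so the estimate
    for quotients applies.\<close>
  have "has_uniform_derivative {()} (\<lambda>s _. f s) (\<lambda>_. f') t"
    using assms(4) unfolding has_vector_derivative_def has_derivative_within_alt2 has_uniform_derivative_def
    by simp
  note quotient = has_uniform_derivative_quotient[OF this]
  have "((\<lambda>s. (f s - f t) /\<^sub>R (s - t)) \<longlongrightarrow> f') (at t)"
  proof (rule tendstoI)
    fix e :: real assume "e > 0"
    then show "\<forall>\<^sub>F s in at t. dist ((f s - f t) /\<^sub>R (s - t)) f' < e"
      using quotient[of "e / 2"] by (auto simp: dist_norm elim!: eventually_mono)
  qed
  moreover have "\<forall>\<^sub>F s in at t. (f s - f t) /\<^sub>R (s - t) \<in> Z"
    using assms(2) by eventually_elim (intro subspace_scale subspace_diff assms(1,3))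
  ultimately show ?thesis
    using closed_subspace[OF assms(1)] by (intro Lim_in_closed_set[of Z _ "at t"]) auto
qed

section \<open>Functions of class C1 up to the boundary\<close>

lemma has_derivative_gradient:
  fixes u :: "'a::euclidean_space \<Rightarrow> real"
  assumes "u differentiable (at x)"
  shows "(u has_derivative (\<lambda>h. h \<bullet> gradient u x)) (at x)"
proof -
  let ?f = "frechet_derivative u (at x)"
  have "(u has_derivative ?f) (at x)"
    using assms frechet_derivative_works by blast
  moreover have "?f = (\<lambda>h. h \<bullet> gradient u x)"
  proof
    fix h
    interpret linear ?f
      using assms by (rule linear_frechet_derivative)
    have "?f h = ?f (\<Sum>i\<in>Basis. (h \<bullet> i) *\<^sub>R i)"
      by (simp add: euclidean_representation)
    also have "\<dots> = h \<bullet> gradient u x"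
      by (simp add: sum scale gradient_def inner_sum_right mult.commute)
    finally show "?f h = h \<bullet> gradient u x" .
  qed
  ultimately show ?thesis by simp
qed

lemma gradient_eq:
  assumes "(u has_derivative (\<lambda>h. h \<bullet> g)) (at x)"
  shows "gradient u x = g"
  using assms by (intro gradient_eqI) (simp add: gderiv_def)

lemma uniformly_continuous_on_cong:
  fixes u v :: "'a::metric_space \<Rightarrow> 'b::metric_space"
  assumes "\<And>x. x \<in> S \<Longrightarrow> u x = v x"
  shows "uniformly_continuous_on S u \<longleftrightarrow> uniformly_continuous_on S v"
  by (simp add: uniformly_continuous_on_def assms)

lemma C1_closure_gradient:
  fixes u :: "'a::euclidean_space \<Rightarrow> real"
  assumes "C1_closure \<Omega> u"
  shows "uniformly_continuous_on \<Omega> (gradient u)"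
  unfolding gradient_def
  by (intro uniformly_continuous_on_sum bounded_linear.uniformly_continuous_on[OF bounded_linear_scaleR_left])
    (use assms in \<open>auto simp: C1_closure_def\<close>)

text \<open>Shaped for \<open>- \<gamma>\<^sub>1 * (\<mu> t x - mean)\<close>: the mean is a number,
  so \<phi>_t inherits the regularity of \<mu>.\<close>

lemma C1_closure_affine:
  fixes u :: "'a::euclidean_space \<Rightarrow> real"
  assumes "C1_closure \<Omega> u"
  shows "C1_closure \<Omega> (\<lambda>x. a * (u x - b))"
proof -
  have der: "((\<lambda>x. a * (u x - b)) has_derivative (\<lambda>h. a * frechet_derivative u (at x) h)) (at x)"
    if "x \<in> \<Omega>" for x
  proof -
    have "(u has_derivative frechet_derivative u (at x)) (at x)"
      using assms that by (simp add: C1_closure_def frechet_derivative_works[symmetric])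
    then show ?thesis
      by (auto intro!: derivative_eq_intros)
  qed
  have eq: "frechet_derivative (\<lambda>x. a * (u x - b)) (at x) = (\<lambda>h. a * frechet_derivative u (at x) h)"
    if "x \<in> \<Omega>" for x
    using frechet_derivative_at[OF der[OF that]] by simp
  show ?thesis
    unfolding C1_closure_def
  proof (intro conjI ballI)
    show "uniformly_continuous_on \<Omega> (\<lambda>x. a * (u x - b))"
      using assms by (intro uniformly_continuous_on_cmul_left uniformly_continuous_on_diff
          uniformly_continuous_on_const) (auto simp: C1_closure_def)
    fix i :: 'a assume i: "i \<in> Basis"
    have "uniformly_continuous_on \<Omega> (\<lambda>x. a * frechet_derivative u (at x) i)"
      using assms i by (intro uniformly_continuous_on_cmul_left) (auto simp: C1_closure_def)
    then show "uniformly_continuous_on \<Omega> (\<lambda>x. frechet_derivative (\<lambda>x. a * (u x - b)) (at x) i)"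
      using eq uniformly_continuous_on_cong[of \<Omega> "\<lambda>x. frechet_derivative (\<lambda>x. a * (u x - b)) (at x) i"]
      by simp
  next
    show "(\<lambda>x. a * (u x - b)) differentiable (at x)" if "x \<in> \<Omega>" for x
      using der[OF that] by (auto simp: differentiable_def)
  qed
qed

lemma frechet_derivative_scaleR:
  fixes w :: "'a::euclidean_space \<Rightarrow> real" and V :: "'a \<Rightarrow> 'b::real_normed_vector"
  assumes "w differentiable (at x)" "V differentiable (at x)"
  shows "((\<lambda>x. w x *\<^sub>R V x) has_derivative
      (\<lambda>h. w x *\<^sub>R frechet_derivative V (at x) h + frechet_derivative w (at x) h *\<^sub>R V x)) (at x)"
    and "frechet_derivative (\<lambda>x. w x *\<^sub>R V x) (at x) =
      (\<lambda>h. w x *\<^sub>R frechet_derivative V (at x) h + frechet_derivative w (at x) h *\<^sub>R V x)"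
proof -
  show *: "((\<lambda>x. w x *\<^sub>R V x) has_derivative
      (\<lambda>h. w x *\<^sub>R frechet_derivative V (at x) h + frechet_derivative w (at x) h *\<^sub>R V x)) (at x)"
    using assms by (intro has_derivative_scaleR) (simp_all add: frechet_derivative_works[symmetric])
  show "frechet_derivative (\<lambda>x. w x *\<^sub>R V x) (at x) =
      (\<lambda>h. w x *\<^sub>R frechet_derivative V (at x) h + frechet_derivative w (at x) h *\<^sub>R V x)"
    using frechet_derivative_at[OF *] by simp
qed

text \<open>Admits the product of \<phi>_t with the gradient of \<phi> as a field in
  \<open>gauss_green_bulk\<close>, which speaks of \<open>C1_closure\<close> fields only.\<close>

lemma C1_closure_scaleR:
  fixes w :: "'a::euclidean_space \<Rightarrow> real" and V :: "'a \<Rightarrow> 'b::euclidean_space"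
  assumes "bounded \<Omega>" "C1_closure \<Omega> w" "C1_closure \<Omega> V"
  shows "C1_closure \<Omega> (\<lambda>x. w x *\<^sub>R V x)"
proof -
  note * = uniformly_continuous_on_bilinear[OF assms(1) _ _ bounded_bilinear_scaleR]
  have diff: "w differentiable (at x)" "V differentiable (at x)" if "x \<in> \<Omega>" for x
    using assms(2,3) that by (auto simp: C1_closure_def)
  show ?thesis
    unfolding C1_closure_def
  proof (intro conjI ballI)
    show "(\<lambda>x. w x *\<^sub>R V x) differentiable (at x)" if "x \<in> \<Omega>" for x
      using frechet_derivative_scaleR(1)[OF diff[OF that]] unfolding differentiable_def by blast
    show "uniformly_continuous_on \<Omega> (\<lambda>x. w x *\<^sub>R V x)"
      using assms(2,3) by (intro *) (auto simp: C1_closure_def)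
    fix i :: 'a assume i: "i \<in> Basis"
    have "uniformly_continuous_on \<Omega>
        (\<lambda>x. w x *\<^sub>R frechet_derivative V (at x) i + frechet_derivative w (at x) i *\<^sub>R V x)"
      using assms(2,3) i by (intro uniformly_continuous_on_add *) (auto simp: C1_closure_def)
    then show "uniformly_continuous_on \<Omega> (\<lambda>x. frechet_derivative (\<lambda>x. w x *\<^sub>R V x) (at x) i)"
      by (rule uniformly_continuous_on_cong[THEN iffD1, rotated])
        (simp add: frechet_derivative_scaleR(2) diff)
  qed
qed

lemma divergence_scaleR:
  fixes w :: "'a::euclidean_space \<Rightarrow> real" and V :: "'a \<Rightarrow> 'a"
  assumes "w differentiable (at x)" "V differentiable (at x)"
  shows "divergence (\<lambda>x. w x *\<^sub>R V x) x = w x * divergence V x + gradient w x \<bullet> V x"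
  by (simp add: divergence_def gradient_def frechet_derivative_scaleR(2)[OF assms] inner_add_left
      sum.distrib sum_distrib_left inner_sum_left inner_commute[of "V x"])

text \<open>The difference quotients in time converge uniformly on \<open>S\<close> together with
  their gradients, so the limit of the gradients is the gradient of the limit. Differentiability of
  \<open>D\<close> is part of the conclusion.\<close>

lemma mixed_derivative:
  fixes u :: "real \<Rightarrow> 'a::euclidean_space \<Rightarrow> real"
  assumes t: "t \<in> {a<..<b}" and S: "open S" "x \<in> S"
    and diff: "\<And>s z. s \<in> {a<..<b} \<Longrightarrow> z \<in> S \<Longrightarrow> (u s) differentiable (at z)"
    and u: "has_uniform_derivative S u D t"
    and grad: "has_uniform_derivative S (\<lambda>s. gradient (u s)) E t"
  shows "(D has_derivative (\<lambda>h. h \<bullet> E x)) (at x)"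
proof -
  obtain r where r: "r > 0" "ball x r \<subseteq> S"
    using S by (meson open_contains_ball)
  \<comment> \<open>The theorem on derivatives of limits is about sequences, so \<open>t\<close> is
    approached along one. The summand 2 keeps even \<open>X 0\<close> strictly between
    \<open>t\<close> and \<open>b\<close>.\<close>
  define X where "X n = t + (b - t) / (2 + real n)" for n
  have "X \<longlonglongrightarrow> t + 0"
    unfolding X_def
    by (intro tendsto_add tendsto_const real_tendsto_divide_at_top[OF tendsto_const]
        filterlim_tendsto_add_at_top[OF tendsto_const] filterlim_real_sequentially)
  moreover have X: "t < X n" "X n < b" for n
  proof -
    have "(b - t) / (2 + real n) < (b - t) / 1"
      using t by (intro divide_strict_left_mono) auto
    then show "t < X n" "X n < b"
      using t by (auto simp: X_def intro!: divide_pos_pos)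
  qed
  ultimately have lim: "filterlim X (at t) sequentially"
    using X(1) by (auto simp: filterlim_at intro!: always_eventually)
  define f where "f n z = (u (X n) z - u t z) /\<^sub>R (X n - t)" for n z
  define g where "g n z = (gradient (u (X n)) z - gradient (u t) z) /\<^sub>R (X n - t)" for n z
  have fD: "(\<lambda>n. f n z) \<longlonglongrightarrow> D z" if "z \<in> S" for z
  proof (rule tendstoI)
    fix e :: real assume "e > 0"
    then have "\<forall>\<^sub>F n in sequentially. \<forall>x\<in>S. norm (f n x - D x) \<le> e / 2"
      unfolding f_def by (intro eventually_compose_filterlim[OF has_uniform_derivative_quotient[OF u] lim]) simp
    then show "\<forall>\<^sub>F n in sequentially. dist (f n z) (D z) < e"
      by eventually_elim (use \<open>e > 0\<close> that in \<open>fastforce simp: dist_norm\<close>)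
  qed
  \<comment> \<open>Convexity is required here, hence a ball instead of \<open>S\<close>. The limit
    function comes out as an unnamed \<open>G\<close> and is identified with \<open>D\<close>
    afterwards.\<close>
  have "\<exists>G. \<forall>z\<in>ball x r. (\<lambda>n. f n z) \<longlonglongrightarrow> G z \<and> (G has_derivative (\<lambda>h. h \<bullet> E z)) (at z within ball x r)"
  proof (rule has_derivative_sequence[where f'="\<lambda>n z h. h \<bullet> g n z"])
    fix n z assume z: "z \<in> ball x r"
    have d: "(u s has_derivative (\<lambda>h. h \<bullet> gradient (u s) z)) (at z within ball x r)"
      if "s \<in> {a<..<b}" for s
      using that z r(2) by (intro has_derivative_at_withinI[OF has_derivative_gradient] diff) auto
    have "X n \<in> {a<..<b}"
      using X[of n] t by auto
    from has_derivative_scaleR_right[OF has_derivative_diff[OF d[OF this] d[OF t]], of "inverse (X n - t)"]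
    show "(f n has_derivative (\<lambda>h. h \<bullet> g n z)) (at z within ball x r)"
      by (simp add: f_def[abs_def] g_def inner_diff_right)
  next
    fix e :: real assume "e > 0"
    then have "\<forall>\<^sub>F n in sequentially. \<forall>x\<in>S. norm (g n x - E x) \<le> e"
      unfolding g_def by (intro eventually_compose_filterlim[OF has_uniform_derivative_quotient[OF grad] lim])
    then show "\<forall>\<^sub>F n in sequentially. \<forall>z\<in>ball x r. \<forall>h. norm (h \<bullet> g n z - h \<bullet> E z) \<le> e * norm h"
    proof (rule eventually_mono, intro ballI allI, goal_cases)
      case (1 n z h)
      have "norm (h \<bullet> g n z - h \<bullet> E z) \<le> norm h * norm (g n z - E z)"
        using Cauchy_Schwarz_ineq2[of h "g n z - E z"] by (simp add: inner_diff_right)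
      also have "\<dots> \<le> norm h * e"
        using 1 r(2) by (intro mult_left_mono) auto
      finally show ?case by (simp add: mult.commute)
    qed
  qed (use r fD[OF S(2)] in auto)
  then obtain G where G: "\<And>z. z \<in> ball x r \<Longrightarrow> (\<lambda>n. f n z) \<longlonglongrightarrow> G z"
    "\<And>z. z \<in> ball x r \<Longrightarrow> (G has_derivative (\<lambda>h. h \<bullet> E z)) (at z within ball x r)"
    by blast
  have "G z = D z" if "z \<in> ball x r" for z
    using G(1)[OF that] fD that r(2) LIMSEQ_unique by blast
  moreover have "(G has_derivative (\<lambda>h. h \<bullet> E x)) (at x)"
    using G(2)[of x] r(1) at_within_open[of x "ball x r"] by simp
  ultimately show ?thesis
    using has_derivative_transform_within_open[of G _ x UNIV "ball x r" D] r(1) by simp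
qed

section \<open>Boundary traces\<close>

lemma at_within_frontier_neq_bot:
  assumes "open \<Omega>" "x \<in> frontier \<Omega>"
  shows "at x within \<Omega> \<noteq> bot"
  using assms by (auto simp: trivial_limit_within frontier_def closure_def interior_open)

lemma boundary_trace_eqI:
  assumes "open \<Omega>" "x \<in> frontier \<Omega>" "(u \<longlongrightarrow> l) (at x within \<Omega>)"
  shows "boundary_trace \<Omega> u x = l"
  unfolding boundary_trace_def using assms at_within_frontier_neq_bot by (intro tendsto_Lim)

lemma boundary_trace_tendsto:
  fixes u :: "'a::metric_space \<Rightarrow> 'b::complete_space"
  assumes "open \<Omega>" "x \<in> frontier \<Omega>" "uniformly_continuous_on \<Omega> u"
  shows "(u \<longlongrightarrow> boundary_trace \<Omega> u x) (at x within \<Omega>)"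
proof -
  have "x \<in> closure \<Omega>" using assms(2) by (simp add: frontier_def)
  then obtain l where l: "(u \<longlongrightarrow> l) (at x within \<Omega>)"
    using uniformly_continuous_on_extension_at_closure[OF assms(3)] by blast
  with boundary_trace_eqI[OF assms(1,2) l] show ?thesis
    by simp
qed

lemma eventually_at_within_ballI:
  assumes "\<And>z. z \<in> S \<Longrightarrow> P z"
  shows "\<forall>\<^sub>F z in at x within S. P z"
  using assms by (simp add: eventually_at_filter)

text \<open>For a fixed \<open>s\<close> the remainder bound holds at every point of \<Omega>, and a
  non-strict inequality survives the limit towards the boundary point.\<close>

lemma has_vector_derivative_boundary_trace:
  fixes u :: "real \<Rightarrow> 'a::metric_space \<Rightarrow> 'b::banach"
  assumes \<Omega>: "open \<Omega>" "x \<in> frontier \<Omega>" and t: "t \<in> {a<..<b}"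
    and u: "\<And>s. s \<in> {a<..<b} \<Longrightarrow> uniformly_continuous_on \<Omega> (u s)"
    and D: "uniformly_continuous_on \<Omega> D" "has_uniform_derivative \<Omega> u D t"
  shows "((\<lambda>s. boundary_trace \<Omega> (u s) x) has_vector_derivative boundary_trace \<Omega> D x) (at t)"
  unfolding has_vector_derivative_def has_derivative_within_alt2
proof (intro conjI allI impI)
  show "bounded_linear (\<lambda>h. h *\<^sub>R boundary_trace \<Omega> D x)" by (rule bounded_linear_scaleR_left)
  fix e :: real assume "e > 0"
  then have "\<forall>\<^sub>F s in at t. \<forall>x\<in>\<Omega>. norm (u s x - u t x - (s - t) *\<^sub>R D x) \<le> e * \<bar>s - t\<bar>"
    using D(2) unfolding has_uniform_derivative_def by blast
  moreover have "\<forall>\<^sub>F s in at t. s \<in> {a<..<b}"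
    using t by (intro eventually_at_in_open') auto
  ultimately show "\<forall>\<^sub>F s in at t. norm (boundary_trace \<Omega> (u s) x - boundary_trace \<Omega> (u t) x
      - (s - t) *\<^sub>R boundary_trace \<Omega> D x) \<le> e * norm (s - t)"
  proof eventually_elim
    case (elim s)
    have "((\<lambda>z. norm (u s z - u t z - (s - t) *\<^sub>R D z)) \<longlongrightarrow> norm (boundary_trace \<Omega> (u s) x
        - boundary_trace \<Omega> (u t) x - (s - t) *\<^sub>R boundary_trace \<Omega> D x)) (at x within \<Omega>)"
      by (intro tendsto_intros boundary_trace_tendsto \<Omega> u elim t D(1))
    then show ?case
      by (rule tendsto_upperbound)
        (use elim(1) at_within_frontier_neq_bot[OF \<Omega>] in \<open>auto intro!: eventually_at_within_ballI\<close>)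
  qed
qed

text \<open>
  The inward push: near \<open>x\<close> the domain lies strictly below the level set of \<open>\<rho>\<close>, and moving along
  \<open>- gradient \<rho> x\<close> by a multiple of \<open>norm (y - x)\<close> dominates the error of linearising \<open>\<rho>\<close>.
\<close>

lemma C1_boundary_push_inward:
  fixes \<Omega> :: "'a::euclidean_space set"
  assumes "C1_boundary \<Omega>" "open \<Omega>" "x \<in> frontier \<Omega>"
  obtains r where "r > 0"
    "\<And>y. y \<in> frontier \<Omega> \<Longrightarrow> y \<noteq> x \<Longrightarrow> norm (y - x) < r \<Longrightarrow>
      \<exists>p. norm p = 3 * norm (y - x) \<and> (\<forall>q\<in>{0<..1}. x + q *\<^sub>R p \<in> \<Omega> \<and> y + q *\<^sub>R p \<in> \<Omega>) \<and>
        closed_segment (x + p) (y + p) \<subseteq> \<Omega>"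
proof -
  obtain U \<rho> where U0: "open U" "x \<in> U" "\<forall>y\<in>U. \<rho> differentiable (at y) \<and> gradient \<rho> y \<noteq> 0"
    "continuous_on U (gradient \<rho>)" "\<Omega> \<inter> U = {y\<in>U. \<rho> y < 0}"
    using bspec[OF assms(1)[unfolded C1_boundary_def] assms(3)] by (elim exE conjE) (rule that)
  then have U: "open U" "x \<in> U" "\<And>y. y \<in> U \<Longrightarrow> \<rho> differentiable (at y)" "gradient \<rho> x \<noteq> 0"
    "isCont (gradient \<rho>) x" "\<And>y. y \<in> U \<Longrightarrow> y \<in> \<Omega> \<longleftrightarrow> \<rho> y < 0"
    by (auto simp: continuous_on_eq_continuous_at)
  define e where "e = gradient \<rho> x"
  define N where "N = norm e"
  have N: "N > 0" using U(4) by (simp add: N_def e_def)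
  have "\<forall>\<^sub>F z in at x. dist (gradient \<rho> z) e < N / 2"
    using U(5) N unfolding e_def isCont_def by (intro tendstoD) auto
  then obtain d1 where d1: "d1 > 0" "\<And>z. z \<noteq> x \<Longrightarrow> dist z x < d1 \<Longrightarrow> dist (gradient \<rho> z) e < N / 2"
    by (auto simp: eventually_at)
  obtain d2 where d2: "d2 > 0" "ball x d2 \<subseteq> U"
    using U(1,2) by (meson open_contains_ball)
  define d where "d = min d1 d2"
  have d: "d > 0" "ball x d \<subseteq> U" using d1(1) d2 by (auto simp: d_def)
  have grad: "norm (gradient \<rho> z - e) \<le> N / 2" if "z \<in> ball x d" for z
    using d1(2)[of z] that N by (cases "z = x") (auto simp: d_def e_def dist_norm norm_minus_commute)
  \<comment> \<open>An error of \<open>N / 2\<close> per unit length is half the slope of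
    \<open>\<rho>\<close> in direction \<open>e\<close>: moving along \<open>- e\<close> lowers
    \<open>\<rho>\<close> by at least half of the linear prediction.\<close>
  have lin: "\<bar>\<rho> v - \<rho> w - (v - w) \<bullet> e\<bar> \<le> N / 2 * norm (v - w)"
    if "v \<in> ball x d" "w \<in> ball x d" for v w
  proof (rule gradient_mean_value[where g="gradient \<rho>"])
    have "closed_segment w v \<subseteq> ball x d"
      using that by (intro closed_segment_subset) auto
    then show "(\<rho> has_derivative (\<lambda>h. h \<bullet> gradient \<rho> z)) (at z)" "norm (gradient \<rho> z - e) \<le> N / 2"
      if "z \<in> closed_segment w v" for z
      using that d(2) grad[of z] by (auto intro!: has_derivative_gradient U(3))
  qed
  \<comment> \<open>A frontier point of the open set lies outside it, so \<open>\<rho>\<close> is at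
    least 0; as a limit of points of \<Omega> it has \<open>\<rho>\<close> at most 0.\<close>
  have zero: "\<rho> y = 0" if y: "y \<in> frontier \<Omega>" "y \<in> U" for y
  proof (rule antisym)
    have "y \<notin> \<Omega>" using y(1) assms(2) by (simp add: frontier_def interior_open)
    then show "0 \<le> \<rho> y" using U(6)[OF y(2)] by simp
    have "isCont \<rho> y"
      using U(3)[OF y(2)] by (rule differentiable_imp_continuous_within)
    then have lim: "(\<rho> \<longlongrightarrow> \<rho> y) (at y within \<Omega>)"
      unfolding isCont_def by (rule tendsto_within_subset) simp
    have "\<forall>\<^sub>F z in at y within \<Omega>. z \<in> U"
      using U(1) y(2) by (intro topological_tendstoD[OF tendsto_ident_at])
    moreover have "\<forall>\<^sub>F z in at y within \<Omega>. z \<in> \<Omega>"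
      by (rule eventually_at_within_ballI)
    ultimately have "\<forall>\<^sub>F z in at y within \<Omega>. \<rho> z \<le> 0"
      by eventually_elim (use U(6) in \<open>simp add: less_imp_le\<close>)
    then show "\<rho> y \<le> 0"
      by (rule tendsto_upperbound[OF lim]) (intro at_within_frontier_neq_bot assms(2) y(1))
  qed
  have inside: "z \<in> \<Omega>" if "z \<in> ball x d" "\<rho> z < 0" for z
    using that U(6)[of z] d(2) by auto
  show thesis
  \<comment> \<open>Every point used below is within \<open>norm (y - x) + norm p\<close>, four
    times \<open>norm (y - x)\<close>, of \<open>x\<close>.\<close>
  proof (rule that[of "d / 4"])
    fix y assume y: "y \<in> frontier \<Omega>" "y \<noteq> x" "norm (y - x) < d / 4"
    define m where "m = norm (y - x)"
    have m: "m > 0" "4 * m < d" using y by (auto simp: m_def)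
    \<comment> \<open>The factor 3, in units of \<open>m * N\<close>: on the segment from
      \<open>x + p\<close> to \<open>y + p\<close> the push contributes -3, the displacement along
      the boundary at most 1/2, and linearising over a length of at most \<open>4 * m\<close> at
      most 2, in total -1/2. A factor \<open>k\<close> would give \<open>1 - k / 2\<close>, so it
      has to exceed 2.\<close>
    define p where "p = - (3 * m / N) *\<^sub>R e"
    have pn: "norm p = 3 * m"
      using N m by (simp add: p_def N_def[symmetric])
    have "e \<bullet> e = N * N"
      by (metis N_def power2_eq_square power2_norm_eq_inner)
    then have pe: "p \<bullet> e = - (3 * m * N)"
      using N by (simp add: p_def)
    have xU: "x \<in> ball x d" "y \<in> ball x d"
      using d(1) m by (simp_all add: m_def[symmetric] dist_norm norm_minus_commute[of x])
    then have \<rho>0: "\<rho> x = 0" "\<rho> y = 0"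
      using zero[OF assms(3) U(2)] zero[OF y(1)] d(2) by auto
    have mN: "m * N > 0" using m N by simp
    have "w + q *\<^sub>R p \<in> \<Omega>" if w: "w \<in> {x, y}" and q: "q \<in> {0<..1}" for w q
    proof (rule inside)
      have qp: "norm (q *\<^sub>R p) \<le> 3 * m"
        using q m by (simp add: pn mult_left_le_one_le)
      have "norm (w + q *\<^sub>R p - x) \<le> norm (w - x) + norm (q *\<^sub>R p)"
        using norm_triangle_ineq[of "w - x" "q *\<^sub>R p"] by (simp add: algebra_simps)
      also have "\<dots> \<le> m + 3 * m"
        using w qp m by (intro add_mono) (auto simp: m_def)
      finally show b: "w + q *\<^sub>R p \<in> ball x d"
        using m by (simp add: dist_norm norm_minus_commute)
      have "\<bar>\<rho> (w + q *\<^sub>R p) - \<rho> w - (w + q *\<^sub>R p - w) \<bullet> e\<bar> \<le> N / 2 * norm (w + q *\<^sub>R p - w)"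
        using b xU w by (intro lin) auto
      then have "\<rho> (w + q *\<^sub>R p) - \<rho> w - q * (p \<bullet> e) \<le> N / 2 * (q * norm p)"
        using q abs_le_D1 by fastforce
      then have "\<rho> (w + q *\<^sub>R p) \<le> q * (p \<bullet> e) + N / 2 * (q * norm p)"
        using w \<rho>0 by auto
      also have "\<dots> = - (3 / 2 * (q * (m * N)))"
        by (simp add: pn pe field_simps)
      also have "\<dots> < 0" using q mN by simp
      finally show "\<rho> (w + q *\<^sub>R p) < 0" .
    qed
    moreover have "closed_segment (x + p) (y + p) \<subseteq> \<Omega>"
    proof
      fix z assume "z \<in> closed_segment (x + p) (y + p)"
      then obtain c where c: "0 \<le> c" "c \<le> 1" "z = (1 - c) *\<^sub>R (x + p) + c *\<^sub>R (y + p)"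
        by (auto simp: closed_segment_def)
      then have zx: "z - x = p + c *\<^sub>R (y - x)"
        by (simp add: algebra_simps)
      have cm: "c * m \<le> m" using c m by (simp add: mult_left_le_one_le)
      have "norm (z - x) \<le> 3 * m + c * m"
        unfolding zx using norm_triangle_ineq[of p "c *\<^sub>R (y - x)"] c by (simp add: pn m_def)
      with cm have z4: "norm (z - x) \<le> 4 * m"
        by simp
      \<comment> \<open>Both points lie on the zero level of \<open>\<rho>\<close>, so
        \<open>y - x\<close> is tangential up to the linearisation error.\<close>
      have "(y - x) \<bullet> e \<le> N / 2 * m"
        using lin[of y x] xU \<rho>0 by (simp add: m_def)
      then have "c * ((y - x) \<bullet> e) \<le> c * (N / 2 * m)"
        using c by (intro mult_left_mono)
      also have "\<dots> \<le> 1 * (N / 2 * m)"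
        using c N m by (intro mult_right_mono) auto
      finally have ce: "c * ((y - x) \<bullet> e) \<le> N / 2 * m" by simp
      show "z \<in> \<Omega>"
      proof (rule inside)
        show b: "z \<in> ball x d"
          using z4 m by (simp add: dist_norm norm_minus_commute)
        have "\<rho> z \<le> (z - x) \<bullet> e + N / 2 * norm (z - x)"
          using abs_le_D1[OF lin[OF b xU(1)]] \<rho>0 by simp
        also have "\<dots> \<le> (- (3 * m * N) + N / 2 * m) + N / 2 * (4 * m)"
        proof (intro add_mono mult_left_mono z4)
          show "(z - x) \<bullet> e \<le> - (3 * m * N) + N / 2 * m"
            unfolding zx inner_add_left pe inner_scaleR_left using ce by linarith
        qed (use N in simp)
        also have "\<dots> = - (m * N / 2)" by (simp add: field_simps)
        also have "\<dots> < 0" using mN by simp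
        finally show "\<rho> z < 0" .
      qed
    qed
    ultimately show "\<exists>p. norm p = 3 * norm (y - x) \<and>
        (\<forall>q\<in>{0<..1}. x + q *\<^sub>R p \<in> \<Omega> \<and> y + q *\<^sub>R p \<in> \<Omega>) \<and> closed_segment (x + p) (y + p) \<subseteq> \<Omega>"
      using pn by (intro exI[of _ p]) (auto simp: m_def)
  qed (use d in simp)
qed

text \<open>The segment from \<open>x\<close> to \<open>y\<close> may leave \<Omega>, so the
  increment is taken along \<open>x\<close>, \<open>x + p\<close>, \<open>y + p\<close>,
  \<open>y\<close>. The three legs have lengths 3, 1 and 3 times \<open>norm (y - x)\<close>, and
  along each the gradient is within \<open>e / 7\<close> of its trace at \<open>x\<close>; the
  contributions of \<open>p\<close> to the linear part cancel.\<close>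

lemma boundary_trace_has_derivative:
  fixes u :: "'a::euclidean_space \<Rightarrow> real"
  assumes "C1_boundary \<Omega>" "open \<Omega>" "x \<in> frontier \<Omega>" "C1_closure \<Omega> u"
  shows "(boundary_trace \<Omega> u has_derivative (\<lambda>h. h \<bullet> boundary_trace \<Omega> (gradient u) x))
    (at x within frontier \<Omega>)"
  unfolding has_derivative_within_alt
proof (intro conjI allI impI)
  let ?A = "boundary_trace \<Omega> (gradient u) x"
  show "bounded_linear (\<lambda>h. h \<bullet> ?A)" by (rule bounded_linear_inner_left)
  fix e :: real assume e: "e > 0"
  have uc: "uniformly_continuous_on \<Omega> u"
    using assms(4) by (simp add: C1_closure_def)
  obtain r where r: "r > 0"
    "\<And>y. y \<in> frontier \<Omega> \<Longrightarrow> y \<noteq> x \<Longrightarrow> norm (y - x) < r \<Longrightarrow>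
      \<exists>p. norm p = 3 * norm (y - x) \<and> (\<forall>q\<in>{0<..1}. x + q *\<^sub>R p \<in> \<Omega> \<and> y + q *\<^sub>R p \<in> \<Omega>) \<and>
        closed_segment (x + p) (y + p) \<subseteq> \<Omega>"
    using C1_boundary_push_inward[OF assms(1-3)] by blast
  have xnot: "y \<notin> \<Omega>" if "y \<in> frontier \<Omega>" for y
    using that assms(2) by (simp add: frontier_def interior_open)
  have "\<forall>\<^sub>F z in at x within \<Omega>. dist (gradient u z) ?A < e / 7"
    using boundary_trace_tendsto[OF assms(2,3) C1_closure_gradient[OF assms(4)]] e by (intro tendstoD) auto
  then obtain d where d: "d > 0" "\<And>z. z \<in> \<Omega> \<Longrightarrow> norm (z - x) < d \<Longrightarrow> norm (gradient u z - ?A) \<le> e / 7"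
    using xnot[OF assms(3)] by (auto simp: eventually_at dist_norm) (metis less_imp_le)
  have mv: "\<bar>u w - u v - (w - v) \<bullet> ?A\<bar> \<le> e / 7 * norm (w - v)"
    if "closed_segment v w \<subseteq> \<Omega>" "closed_segment v w \<subseteq> ball x d" for v w
  proof (rule gradient_mean_value[where g="gradient u"])
    fix z assume "z \<in> closed_segment v w"
    then have z: "z \<in> \<Omega>" "norm (z - x) < d"
      using that by (auto simp: subset_iff dist_norm norm_minus_commute)
    show "(u has_derivative (\<lambda>h. h \<bullet> gradient u z)) (at z)"
      using assms(4) z(1) by (intro has_derivative_gradient) (simp add: C1_closure_def)
    show "norm (gradient u z - ?A) \<le> e / 7"
      by (rule d(2)[OF z])
  qed
  show "\<exists>d>0. \<forall>y\<in>frontier \<Omega>. norm (y - x) < d \<longrightarrow>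
      norm (boundary_trace \<Omega> u y - boundary_trace \<Omega> u x - (y - x) \<bullet> ?A) \<le> e * norm (y - x)"
  \<comment> \<open>The detour stays within \<open>4 * norm (y - x)\<close> of
    \<open>x\<close>.\<close>
  proof (intro exI[of _ "min r (d / 4)"] conjI ballI impI)
    fix y assume y: "y \<in> frontier \<Omega>" "norm (y - x) < min r (d / 4)"
    show "norm (boundary_trace \<Omega> u y - boundary_trace \<Omega> u x - (y - x) \<bullet> ?A) \<le> e * norm (y - x)"
    proof (cases "y = x")
      case False
      then obtain p where p: "norm p = 3 * norm (y - x)"
        "\<And>q. q \<in> {0<..1} \<Longrightarrow> x + q *\<^sub>R p \<in> \<Omega> \<and> y + q *\<^sub>R p \<in> \<Omega>" "closed_segment (x + p) (y + p) \<subseteq> \<Omega>"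
        using r(2)[of y] y by auto
      have near: "w + q *\<^sub>R p \<in> ball x d" if "w \<in> {x, y}" "q \<in> {0..1}" for w q
      proof -
        have "norm (w + q *\<^sub>R p - x) \<le> norm (w - x) + q * norm p"
          using norm_triangle_ineq[of "w - x" "q *\<^sub>R p"] that by (simp add: algebra_simps)
        also have "\<dots> \<le> norm (y - x) + 1 * norm p"
          using that by (intro add_mono mult_right_mono) auto
        also have "\<dots> < d" using p(1) y(2) by simp
        finally show ?thesis by (simp add: dist_norm norm_minus_commute)
      qed
      \<comment> \<open>This leg starts on the boundary, where \<open>u\<close> has a trace but no
        derivative. The mean value estimate is used from \<open>w + q *\<^sub>R p\<close> on, inside
        \<Omega>, and then \<open>q\<close> tends to 0 from the right.\<close>
      have push: "\<bar>u (w + p) - boundary_trace \<Omega> u w - p \<bullet> ?A\<bar> \<le> e / 7 * norm p" if w: "w \<in> {x, y}" for w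
      proof -
        have wf: "w \<in> frontier \<Omega>" using w y(1) assms(3) by auto
        have "p \<noteq> 0" using p(1) False by auto
        have "filterlim (\<lambda>q. w + q *\<^sub>R p) (at w within \<Omega>) (at_right 0)"
        proof -
          have "((\<lambda>q. w + q *\<^sub>R p) \<longlongrightarrow> w + 0 *\<^sub>R p) (at_right 0)"
            by (intro tendsto_intros)
          moreover have "\<forall>\<^sub>F q in at_right 0. w + q *\<^sub>R p \<in> \<Omega> \<and> w + q *\<^sub>R p \<noteq> w"
            using p(2) w \<open>p \<noteq> 0\<close> by (auto simp: eventually_at_right_less eventually_at_right_field intro!: exI[of _ 1])
          ultimately show ?thesis by (simp add: filterlim_at)
        qed
        from filterlim_compose[OF boundary_trace_tendsto[OF assms(2) wf uc] this]
        have "((\<lambda>q. \<bar>u (w + p) - u (w + q *\<^sub>R p) - (p - q *\<^sub>R p) \<bullet> ?A\<bar>) \<longlongrightarrow>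
          \<bar>u (w + p) - boundary_trace \<Omega> u w - (p - 0 *\<^sub>R p) \<bullet> ?A\<bar>) (at_right 0)"
          by (intro tendsto_intros)
        then have "\<bar>u (w + p) - boundary_trace \<Omega> u w - (p - 0 *\<^sub>R p) \<bullet> ?A\<bar> \<le> e / 7 * norm p"
        proof (rule tendsto_upperbound)
          have "\<bar>u (w + p) - u (w + q *\<^sub>R p) - (p - q *\<^sub>R p) \<bullet> ?A\<bar> \<le> e / 7 * norm p"
            if q: "q \<in> {0<..<1}" for q
          proof -
            have seg: "\<exists>q'\<in>{0<..1}. z = w + q' *\<^sub>R p" if "z \<in> closed_segment (w + q *\<^sub>R p) (w + p)" for z
            proof -
              obtain c where c: "0 \<le> c" "c \<le> 1" "z = (1 - c) *\<^sub>R (w + q *\<^sub>R p) + c *\<^sub>R (w + p)"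
                using \<open>z \<in> _\<close> by (auto simp: closed_segment_def)
              have "z = w + ((1 - c) * q + c) *\<^sub>R p"
                using c(3) by (simp add: algebra_simps)
              moreover have "(1 - c) * q + c = q + c * (1 - q)"
                by (simp add: algebra_simps)
              moreover have "q + c * (1 - q) > 0" using q c by (simp add: add_pos_nonneg)
              moreover have "q + c * (1 - q) \<le> q + 1 * (1 - q)"
                using q c by (intro add_left_mono mult_right_mono) auto
              ultimately show ?thesis by (intro bexI[of _ "(1 - c) * q + c"]) auto
            qed
            have "\<bar>u (w + p) - u (w + q *\<^sub>R p) - ((w + p) - (w + q *\<^sub>R p)) \<bullet> ?A\<bar>
                \<le> e / 7 * norm ((w + p) - (w + q *\<^sub>R p))"
              using seg p(2) near[OF w] w by (intro mv subsetI) fastforce+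
            also have "(w + p) - (w + q *\<^sub>R p) = (1 - q) *\<^sub>R p"
              by (simp add: algebra_simps)
            also have "e / 7 * norm ((1 - q) *\<^sub>R p) \<le> e / 7 * norm p"
              using q e by (intro mult_left_mono) (auto simp: mult_left_le_one_le)
            finally show ?thesis by (simp add: algebra_simps)
          qed
          then show "\<forall>\<^sub>F q in at_right 0. \<bar>u (w + p) - u (w + q *\<^sub>R p) - (p - q *\<^sub>R p) \<bullet> ?A\<bar> \<le> e / 7 * norm p"
            by (auto simp: eventually_at_right_field intro!: exI[of _ 1])
        qed simp
        then show ?thesis by simp
      qed
      have "closed_segment (x + p) (y + p) \<subseteq> ball x d"
        using near[of x 1] near[of y 1] by (intro closed_segment_subset) auto
      from mv[OF p(3) this]
      have "\<bar>u (y + p) - u (x + p) - (y - x) \<bullet> ?A\<bar> \<le> e / 7 * norm (y - x)"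
        by simp
      with push[of x] push[of y] show ?thesis
        unfolding p(1) real_norm_def by (simp add: field_simps) argo
    qed simp
  qed (use r(1) d(1) in simp)
qed

section \<open>Tangential gradients\<close>

lemma tangential_gradient_eqI:
  assumes "has_tangential_gradient \<Gamma> u x v"
  shows "tangential_gradient \<Gamma> u x = v"
  unfolding tangential_gradient_def
  by (rule the_equality[where P="has_tangential_gradient \<Gamma> u x", OF assms])
    (rule has_tangential_gradient_unique[OF _ assms])

lemma has_tangential_gradient_tangential_gradient:
  assumes "\<exists>v. has_tangential_gradient \<Gamma> u x v"
  shows "has_tangential_gradient \<Gamma> u x (tangential_gradient \<Gamma> u x)"
proof -
  obtain v where "has_tangential_gradient \<Gamma> u x v"
    using assms by (rule exE)
  then show ?thesis
    by (simp add: tangential_gradient_eqI)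
qed

lemma has_tangential_gradient_cong:
  assumes "\<And>y. y \<in> \<Gamma> \<Longrightarrow> u y = v y" "x \<in> \<Gamma>"
  shows "has_tangential_gradient \<Gamma> u x a \<longleftrightarrow> has_tangential_gradient \<Gamma> v x a"
  unfolding has_tangential_gradient_def
  using has_derivative_transform[OF assms(2), of u v] has_derivative_transform[OF assms(2), of v u] assms(1)
  by auto

lemma subspace_tangent_space: "subspace (tangent_space \<Gamma> x)"
  unfolding tangent_space_def by (rule subspace_span)

lemma has_tangential_gradient_mult:
  assumes "has_tangential_gradient \<Gamma> u x a" "has_tangential_gradient \<Gamma> v x b"
  shows "has_tangential_gradient \<Gamma> (\<lambda>y. u y * v y) x (u x *\<^sub>R b + v x *\<^sub>R a)"
  unfolding has_tangential_gradient_def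
proof
  show "u x *\<^sub>R b + v x *\<^sub>R a \<in> tangent_space \<Gamma> x"
    using assms unfolding has_tangential_gradient_def
    by (intro subspace_add subspace_scale subspace_tangent_space) auto
  have "((\<lambda>y. u y * v y) has_derivative (\<lambda>h. u x * (h \<bullet> b) + (h \<bullet> a) * v x)) (at x within \<Gamma>)"
    using assms unfolding has_tangential_gradient_def by (intro has_derivative_mult) auto
  then show "((\<lambda>y. u y * v y) has_derivative (\<lambda>h. h \<bullet> (u x *\<^sub>R b + v x *\<^sub>R a))) (at x within \<Gamma>)"
    by (simp add: inner_add_right mult.commute)
qed

lemma C1_surfaceD:
  assumes "C1_surface \<Gamma> u" "x \<in> \<Gamma>"
  shows "has_tangential_gradient \<Gamma> u x (tangential_gradient \<Gamma> u x)"
  using assms by (intro has_tangential_gradient_tangential_gradient) (simp add: C1_surface_def)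

lemma C1_surface_continuous:
  assumes "C1_surface \<Gamma> u"
  shows "continuous_on \<Gamma> u"
  unfolding continuous_on_eq_continuous_within
proof
  fix x assume "x \<in> \<Gamma>"
  from C1_surfaceD[OF assms this] show "continuous (at x within \<Gamma>) u"
    unfolding has_tangential_gradient_def by (elim conjE) (rule has_derivative_continuous)
qed

lemma C1_surfaceI:
  assumes "\<And>x. x \<in> \<Gamma> \<Longrightarrow> has_tangential_gradient \<Gamma> u x (g x)" "continuous_on \<Gamma> g"
  shows "C1_surface \<Gamma> u"
  unfolding C1_surface_def
proof (intro conjI ballI)
  show "\<exists>v. has_tangential_gradient \<Gamma> u x v" if "x \<in> \<Gamma>" for x
    using assms(1)[OF that] by (rule exI)
  show "continuous_on \<Gamma> (tangential_gradient \<Gamma> u)"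
    using assms(2) by (rule continuous_on_cong[THEN iffD1, rotated 2])
      (simp_all add: tangential_gradient_eqI[OF assms(1)])
qed

text \<open>The surface counterpart of \<open>C1_closure_scaleR\<close>: it makes the product of
  \<psi>_t with the tangential gradient of \<psi> admissible in
  \<open>gauss_green_surface\<close>.\<close>

lemma C1_tangential_field_scaleR:
  fixes \<Gamma> :: "'a::euclidean_space set"
  assumes "C1_surface \<Gamma> w" "C1_tangential_field \<Gamma> V"
  shows "C1_tangential_field \<Gamma> (\<lambda>x. w x *\<^sub>R V x)"
  unfolding C1_tangential_field_def
proof (intro conjI ballI)
  show "w x *\<^sub>R V x \<in> tangent_space \<Gamma> x" if "x \<in> \<Gamma>" for x
    using assms(2) that by (intro subspace_scale subspace_tangent_space) (simp add: C1_tangential_field_def)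
  fix i :: 'a assume "i \<in> Basis"
  then have V: "C1_surface \<Gamma> (\<lambda>y. V y \<bullet> i)"
    using assms(2) by (simp add: C1_tangential_field_def)
  show "C1_surface \<Gamma> (\<lambda>y. w y *\<^sub>R V y \<bullet> i)"
    unfolding inner_scaleR_left
  proof (rule C1_surfaceI)
    show "has_tangential_gradient \<Gamma> (\<lambda>y. w y * (V y \<bullet> i)) x
        (w x *\<^sub>R tangential_gradient \<Gamma> (\<lambda>y. V y \<bullet> i) x + (V x \<bullet> i) *\<^sub>R tangential_gradient \<Gamma> w x)"
      if "x \<in> \<Gamma>" for x
      by (intro has_tangential_gradient_mult C1_surfaceD assms(1) V that)
    show "continuous_on \<Gamma> (\<lambda>x. w x *\<^sub>R tangential_gradient \<Gamma> (\<lambda>y. V y \<bullet> i) x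
        + (V x \<bullet> i) *\<^sub>R tangential_gradient \<Gamma> w x)"
      using V assms(1) C1_surface_continuous[OF V] C1_surface_continuous[OF assms(1)]
      by (intro continuous_on_add continuous_on_scaleR) (simp_all add: C1_surface_def)
  qed
qed

lemma surface_divergence_scaleR:
  fixes \<Gamma> :: "'a::euclidean_space set"
  assumes "C1_surface \<Gamma> w" "C1_tangential_field \<Gamma> V" "x \<in> \<Gamma>"
  shows "surface_divergence \<Gamma> (\<lambda>x. w x *\<^sub>R V x) x
    = w x * surface_divergence \<Gamma> V x + tangential_gradient \<Gamma> w x \<bullet> V x"
proof -
  have "tangential_gradient \<Gamma> (\<lambda>y. w y *\<^sub>R V y \<bullet> i) x
      = w x *\<^sub>R tangential_gradient \<Gamma> (\<lambda>y. V y \<bullet> i) x + (V x \<bullet> i) *\<^sub>R tangential_gradient \<Gamma> w x"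
    if "i \<in> Basis" for i
    unfolding inner_scaleR_left using assms(2) that
    by (intro tangential_gradient_eqI has_tangential_gradient_mult C1_surfaceD assms(1,3))
      (simp add: C1_tangential_field_def)
  then have "surface_divergence \<Gamma> (\<lambda>x. w x *\<^sub>R V x) x
      = (\<Sum>i\<in>Basis. w x * (tangential_gradient \<Gamma> (\<lambda>y. V y \<bullet> i) x \<bullet> i)
          + (tangential_gradient \<Gamma> w x \<bullet> i) * (V x \<bullet> i))"
    unfolding surface_divergence_def
    by (intro sum.cong refl) (simp add: inner_add_left mult.commute)
  also have "\<dots> = w x * surface_divergence \<Gamma> V x + tangential_gradient \<Gamma> w x \<bullet> V x"
    by (simp add: sum.distrib sum_distrib_left surface_divergence_def
        euclidean_inner[of "tangential_gradient \<Gamma> w x" "V x"])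
  finally show ?thesis .
qed

lemma continuous_on_surface_divergence:
  assumes "C1_tangential_field \<Gamma> V"
  shows "continuous_on \<Gamma> (surface_divergence \<Gamma> V)"
  unfolding surface_divergence_def
  by (intro continuous_on_sum continuous_on_inner continuous_on_const)
    (use assms in \<open>simp add: C1_tangential_field_def C1_surface_def\<close>)

text \<open>
  Derivatives within \<open>\<Gamma>\<close> are not unique; these vectors are the ambiguity of a gradient along \<open>\<Gamma>\<close>.
\<close>

definition null_gradients :: "'a::euclidean_space set \<Rightarrow> 'a \<Rightarrow> 'a set" where
  "null_gradients \<Gamma> x = {d. ((\<lambda>_. 0::real) has_derivative (\<lambda>h. h \<bullet> d)) (at x within \<Gamma>)}"

lemma subspace_null_gradients: "subspace (null_gradients \<Gamma> x)"
proof (rule subspaceI)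
  show "0 \<in> null_gradients \<Gamma> x"
    by (simp add: null_gradients_def)
  fix v w and c :: real assume v: "v \<in> null_gradients \<Gamma> x"
  then show "c *\<^sub>R v \<in> null_gradients \<Gamma> x"
    using has_derivative_mult_right[of "\<lambda>_. 0" "\<lambda>h. h \<bullet> v" "at x within \<Gamma>" c]
    by (simp add: null_gradients_def)
  assume "w \<in> null_gradients \<Gamma> x"
  with v show "v + w \<in> null_gradients \<Gamma> x"
    using has_derivative_add[of "\<lambda>_. 0" "\<lambda>h. h \<bullet> v" "at x within \<Gamma>" "\<lambda>_. 0" "\<lambda>h. h \<bullet> w"]
    by (simp add: null_gradients_def inner_add_right)
qed

lemma diff_mem_null_gradients:
  assumes "(u has_derivative (\<lambda>h. h \<bullet> a)) (at x within \<Gamma>)"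
    and "(u has_derivative (\<lambda>h. h \<bullet> b)) (at x within \<Gamma>)"
  shows "a - b \<in> null_gradients \<Gamma> x"
  using has_derivative_diff[OF assms] by (simp add: null_gradients_def inner_diff_right)

lemma has_derivative_diff_null_gradients:
  assumes "(u has_derivative (\<lambda>h. h \<bullet> a)) (at x within \<Gamma>)" "a - b \<in> null_gradients \<Gamma> x"
  shows "(u has_derivative (\<lambda>h. h \<bullet> b)) (at x within \<Gamma>)"
  using has_derivative_diff[OF assms(1) assms(2)[unfolded null_gradients_def mem_Collect_eq]]
  by (simp add: inner_diff_right)

text \<open>
  At every time the traced gradient and the tangential gradient represent the same differential along
  the boundary, so they differ by an element of a fixed closed subspace; hence so do their time
  derivatives.
\<close>

lemma has_tangential_gradient_time_derivative:
  fixes \<Omega> :: "'a::euclidean_space set"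
  assumes \<Omega>: "C1_boundary \<Omega>" "open \<Omega>" "x \<in> frontier \<Omega>" and t: "t \<in> {a<..<b}"
    and u: "\<And>s. s \<in> {a<..<b} \<Longrightarrow> C1_closure \<Omega> (u s)" "C1_closure \<Omega> w"
      "has_uniform_derivative \<Omega> (\<lambda>s. gradient (u s)) (gradient w) t"
    and g: "\<And>s. s \<in> {a<..<b} \<Longrightarrow> has_tangential_gradient (frontier \<Omega>) (boundary_trace \<Omega> (u s)) x (g s)"
      "(g has_vector_derivative g') (at t)"
  shows "has_tangential_gradient (frontier \<Omega>) (boundary_trace \<Omega> w) x g'"
proof -
  have ev: "\<forall>\<^sub>F s in at t. P s" if "\<And>s. s \<in> {a<..<b} \<Longrightarrow> P s" for P
    using t eventually_at_in_open'[of "{a<..<b}" t] that by (auto elim!: eventually_mono)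
  have null: "boundary_trace \<Omega> (gradient (u s)) x - g s \<in> null_gradients (frontier \<Omega>) x"
    if "s \<in> {a<..<b}" for s
    using boundary_trace_has_derivative[OF \<Omega> u(1)[OF that]] g(1)[OF that]
    by (intro diff_mem_null_gradients) (auto simp: has_tangential_gradient_def)
  have "((\<lambda>s. boundary_trace \<Omega> (gradient (u s)) x - g s) has_vector_derivative
      boundary_trace \<Omega> (gradient w) x - g') (at t)"
    by (intro has_vector_derivative_diff g(2) has_vector_derivative_boundary_trace[OF \<Omega>(2,3) t]
        C1_closure_gradient u)
  then have "boundary_trace \<Omega> (gradient w) x - g' \<in> null_gradients (frontier \<Omega>) x"
    by (rule has_vector_derivative_mem_subspace[OF subspace_null_gradients, rotated 2])
      (rule ev, rule null, assumption, rule null[OF t])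
  with boundary_trace_has_derivative[OF \<Omega> u(2)]
  have "(boundary_trace \<Omega> w has_derivative (\<lambda>h. h \<bullet> g')) (at x within frontier \<Omega>)"
    by (rule has_derivative_diff_null_gradients)
  \<comment> \<open>The point \<open>x\<close> does not move in time, so all \<open>g s\<close> lie
    in one and the same subspace.\<close>
  moreover have "g' \<in> tangent_space (frontier \<Omega>) x"
    by (rule has_vector_derivative_mem_subspace[OF subspace_tangent_space ev _ g(2)])
      (use g(1) t in \<open>simp_all add: has_tangential_gradient_def\<close>)
  ultimately show ?thesis
    by (simp add: has_tangential_gradient_def)
qed

section \<open>Energy dissipation\<close>

lemma DERIV_double_well: "(double_well has_real_derivative s ^ 3 - s) (at s)"
  unfolding double_well_def[abs_def]
  by (auto intro!: derivative_eq_intros simp: field_simps power2_eq_square power3_eq_cube)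

lemma DERIV_moving_contact_line:
  "(moving_contact_line c \<theta> has_real_derivative - (c / 2) * cos \<theta> * (cos (pi / 2 * s) * (pi / 2))) (at s)"
  unfolding moving_contact_line_def[abs_def] by (auto intro!: derivative_eq_intros)

text \<open>Serves both energies: \<open>double_well\<close> is itself one of the two cases, so it
  also covers the bulk potential.\<close>

lemma potential_C1:
  assumes "G = double_well \<or> (\<exists>c \<theta>. G = moving_contact_line c \<theta>)"
  shows "(G has_real_derivative deriv G s) (at s)" and "continuous_on UNIV (deriv G)"
proof -
  have "\<exists>g. (\<forall>s. (G has_real_derivative g s) (at s)) \<and> continuous_on UNIV g"
    using assms
  proof (elim disjE exE)
    assume "G = double_well"
    then show ?thesis
      using DERIV_double_well by (intro exI[of _ "\<lambda>s. s ^ 3 - s"]) (auto intro!: continuous_intros)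
  next
    fix c \<theta> assume "G = moving_contact_line c \<theta>"
    then show ?thesis
      using DERIV_moving_contact_line
      by (intro exI[of _ "\<lambda>s. - (c / 2) * cos \<theta> * (cos (pi / 2 * s) * (pi / 2))"])
        (auto intro!: continuous_intros)
  qed
  then obtain g where g: "\<And>s. (G has_real_derivative g s) (at s)" "continuous_on UNIV g"
    by blast
  then have "deriv G = g"
    by (intro ext DERIV_imp_deriv)
  with g show "(G has_real_derivative deriv G s) (at s)" "continuous_on UNIV (deriv G)"
    by simp_all
qed

lemma bounded_continuous_on_laplacian:
  fixes u :: "'a::euclidean_space \<Rightarrow> real"
  assumes "bounded \<Omega>" "C2_closure \<Omega> u"
  shows "bounded_continuous_on \<Omega> (laplacian u)"
proof (rule bounded_continuous_on_uniform[OF assms(1)])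
  show "uniformly_continuous_on \<Omega> (laplacian u)"
    unfolding laplacian_def divergence_def
    by (intro uniformly_continuous_on_sum bounded_linear.uniformly_continuous_on[OF bounded_linear_inner_left])
      (use assms(2) in \<open>simp add: C2_closure_def C1_closure_def\<close>)
qed

theorem theorem2:
  fixes \<Omega> \<Gamma> :: "'a::euclidean_space set" and n :: "'a \<Rightarrow> 'a"
    and \<phi> \<mu> \<psi> \<mu>\<^sub>\<Gamma> :: "real \<Rightarrow> 'a \<Rightarrow> real" and G :: "real \<Rightarrow> real"
    and T \<gamma>\<^sub>1 \<gamma>\<^sub>2 \<kappa> :: real
  assumes domain: "open \<Omega>" "connected \<Omega>" "bounded \<Omega>" "\<Omega> \<noteq> {}"
    and boundary: "\<Gamma> = frontier \<Omega>" "C1_boundary \<Omega>" "emeasure surface_measure \<Gamma> < \<infinity>"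
    and normal: "\<And>x. x \<in> \<Gamma> \<Longrightarrow> outward_unit_normal \<Omega> x (n x)"
    and gauss_green: "gauss_green_bulk \<Omega> n" "gauss_green_surface \<Gamma>"
    and constants: "T > 0" "\<gamma>\<^sub>1 > 0" "\<gamma>\<^sub>2 > 0" "\<kappa> > 0"
    and potential: "G = double_well \<or> (\<exists>\<gamma> \<theta>. G = moving_contact_line \<gamma> \<theta>)"
    and regularity_\<phi>: "\<And>t. t \<in> {0<..<T} \<Longrightarrow> C2_closure \<Omega> (\<phi> t)"
      "time_C1 T \<Omega> \<phi>" "time_C1 T \<Omega> (\<lambda>t. gradient (\<phi> t))"
    and regularity_\<psi>: "\<And>t. t \<in> {0<..<T} \<Longrightarrow> C2_surface \<Gamma> (\<psi> t)"
      "time_C1 T \<Gamma> \<psi>" "time_C1 T \<Gamma> (\<lambda>t. tangential_gradient \<Gamma> (\<psi> t))"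
    and regularity_\<mu>: "\<And>t. t \<in> {0<..<T} \<Longrightarrow> C1_closure \<Omega> (\<mu> t)"
    and \<phi>_eq: "\<And>t x. t \<in> {0<..<T} \<Longrightarrow> x \<in> \<Omega> \<Longrightarrow>
      ((\<lambda>s. \<phi> s x) has_real_derivative - \<gamma>\<^sub>1 * proj_bulk \<Omega> (\<mu> t) x) (at t)"
    and \<mu>_eq: "\<And>t x. t \<in> {0<..<T} \<Longrightarrow> x \<in> \<Omega> \<Longrightarrow>
      \<mu> t x = - \<kappa>\<^sup>2 * laplacian (\<phi> t) x + deriv double_well (\<phi> t x)"
    and \<mu>_bc: "\<And>t x. t \<in> {0<..<T} \<Longrightarrow> x \<in> \<Gamma> \<Longrightarrow> normal_derivative \<Omega> n (\<mu> t) x = 0"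
    and trace_eq: "\<And>t x. t \<in> {0<..<T} \<Longrightarrow> x \<in> \<Gamma> \<Longrightarrow> boundary_trace \<Omega> (\<phi> t) x = \<psi> t x"
    and \<psi>_eq: "\<And>t x. t \<in> {0<..<T} \<Longrightarrow> x \<in> \<Gamma> \<Longrightarrow>
      ((\<lambda>s. \<psi> s x) has_real_derivative - \<gamma>\<^sub>2 * proj_surface \<Gamma> (\<mu>\<^sub>\<Gamma> t) x) (at t)"
    and \<mu>\<^sub>\<Gamma>_eq: "\<And>t x. t \<in> {0<..<T} \<Longrightarrow> x \<in> \<Gamma> \<Longrightarrow>
      \<mu>\<^sub>\<Gamma> t x = - \<kappa>\<^sup>2 * laplace_beltrami \<Gamma> (\<psi> t) x + deriv G (\<psi> t x)
        + \<kappa>\<^sup>2 * normal_derivative \<Omega> n (\<phi> t) x"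
  shows "\<forall>t\<in>{0<..<T}. \<exists>D. ((\<lambda>s. total_energy \<kappa> G \<Omega> (\<phi> s) (\<psi> s)) has_real_derivative D) (at t) \<and> D \<le> 0"
proof
  fix t assume t: "t \<in> {0<..<T}"
  have \<Omega>: "sets (lborel :: 'a measure) = sets borel" "\<Omega> \<in> sets borel" "emeasure lborel \<Omega> < \<infinity>"
    using domain(1,3) emeasure_bounded_finite by auto
  have compact: "compact \<Gamma>"
    unfolding boundary(1) by (rule compact_frontier_bounded[OF domain(3)])
  then have \<Gamma>: "sets (surface_measure :: 'a measure) = sets borel" "\<Gamma> \<in> sets borel" "emeasure surface_measure \<Gamma> < \<infinity>"
    using boundary(3) sets_surface_measure by (auto intro: borel_compact)
  note int\<^sub>\<Omega> = set_integrable_bounded_continuous_on[OF \<Omega>]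
    and int\<^sub>\<Gamma> = set_integrable_bounded_continuous_on[OF \<Gamma>]
    and bc\<^sub>\<Omega> = bounded_continuous_on_uniform[OF domain(3)]
    and bc\<^sub>\<Gamma> = bounded_continuous_on_compact[OF compact]
  note F = potential_C1[of double_well] and G = potential_C1[OF potential]

  \<comment> \<open>Time derivatives in the bulk\<close>
  define w where "w = (\<lambda>x. - \<gamma>\<^sub>1 * proj_bulk \<Omega> (\<mu> t) x)"
  define z where "z = (\<lambda>x. - \<gamma>\<^sub>2 * proj_surface \<Gamma> (\<mu>\<^sub>\<Gamma> t) x)"
  have \<phi>_C1: "C1_closure \<Omega> (\<phi> s)" "C1_closure \<Omega> (gradient (\<phi> s))" if "s \<in> {0<..<T}" for s
    using regularity_\<phi>(1)[OF that] by (simp_all add: C2_closure_def)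
  have w_C1: "C1_closure \<Omega> w"
    unfolding w_def mean_free_def by (intro C1_closure_affine regularity_\<mu> t)
  have uc: "uniformly_continuous_on \<Omega> u" if "C1_closure \<Omega> u" for u :: "'a \<Rightarrow> 'b::real_normed_vector"
    using that by (simp add: C1_closure_def)
  have \<phi>_t_eq: "vector_derivative (\<lambda>s. \<phi> s x) (at t) = w x" if "x \<in> \<Omega>" for x
    using \<phi>_eq[OF t that] unfolding w_def
    by (intro vector_derivative_at) (simp add: has_real_derivative_iff_has_vector_derivative)
  have \<phi>_t: "has_uniform_derivative \<Omega> \<phi> w t"
    by (rule has_uniform_derivative_cong[THEN iffD1,
          OF \<phi>_t_eq time_C1_has_uniform_derivative[OF regularity_\<phi>(2) t]])
  \<comment> \<open>Differentiating the energy produces the time derivative of the gradient, while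
    Green's formula needs the gradient of \<open>w\<close>.\<close>
  have grad\<phi>_t_eq: "vector_derivative (\<lambda>s. gradient (\<phi> s) x) (at t) = gradient w x" if "x \<in> \<Omega>" for x
    using \<phi>_C1(1) that
    by (intro gradient_eq[symmetric] mixed_derivative[OF t domain(1) that _ \<phi>_t
          time_C1_has_uniform_derivative[OF regularity_\<phi>(3) t]]) (simp add: C1_closure_def)
  have grad\<phi>_t: "has_uniform_derivative \<Omega> (\<lambda>s. gradient (\<phi> s)) (gradient w) t"
    by (rule has_uniform_derivative_cong[THEN iffD1,
          OF grad\<phi>_t_eq time_C1_has_uniform_derivative[OF regularity_\<phi>(3) t]])

  \<comment> \<open>Time derivatives on the boundary\<close>
  define g where "g = (\<lambda>x. vector_derivative (\<lambda>s. tangential_gradient \<Gamma> (\<psi> s) x) (at t))"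
  have \<psi>_C1: "C1_surface \<Gamma> (\<psi> s)" "C1_tangential_field \<Gamma> (tangential_gradient \<Gamma> (\<psi> s))"
    if "s \<in> {0<..<T}" for s
    using regularity_\<psi>(1)[OF that] by (simp_all add: C2_surface_def)
  have \<psi>_t_eq: "vector_derivative (\<lambda>s. \<psi> s x) (at t) = z x" if "x \<in> \<Gamma>" for x
    using \<psi>_eq[OF t that] unfolding z_def
    by (intro vector_derivative_at) (simp add: has_real_derivative_iff_has_vector_derivative)
  have \<psi>_t: "has_uniform_derivative \<Gamma> \<psi> z t"
    by (rule has_uniform_derivative_cong[THEN iffD1,
          OF \<psi>_t_eq time_C1_has_uniform_derivative[OF regularity_\<psi>(2) t]])
  have grad\<psi>_t: "has_uniform_derivative \<Gamma> (\<lambda>s. tangential_gradient \<Gamma> (\<psi> s)) g t"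
    unfolding g_def by (rule time_C1_has_uniform_derivative[OF regularity_\<psi>(3) t])
  have g_cont: "continuous_on \<Gamma> g"
    unfolding g_def
    by (intro uniformly_continuous_imp_continuous time_C1_uniformly_continuous[OF regularity_\<psi>(3) t])
  \<comment> \<open>The trace condition holds at all times of the open interval, so it can be
    differentiated in time at \<open>t\<close>.\<close>
  have trace_w: "boundary_trace \<Omega> w x = z x" if x: "x \<in> \<Gamma>" for x
  proof -
    have "((\<lambda>s. boundary_trace \<Omega> (\<phi> s) x) has_vector_derivative boundary_trace \<Omega> w x) (at t)"
      using x boundary(1)
      by (intro has_vector_derivative_boundary_trace[OF domain(1) _ t] uc \<phi>_C1 w_C1 \<phi>_t) auto
    then have "((\<lambda>s. \<psi> s x) has_vector_derivative boundary_trace \<Omega> w x) (at t)"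
      using t trace_eq[OF _ x]
      by (elim has_vector_derivative_transform_within_open[where S="{0<..<T}"]) auto
    moreover have "((\<lambda>s. \<psi> s x) has_vector_derivative z x) (at t)"
      by (rule has_uniform_derivative_imp_has_vector_derivative[OF \<psi>_t x])
    ultimately show ?thesis
      by (rule vector_derivative_unique_at)
  qed
  have tangential_z: "has_tangential_gradient \<Gamma> z x (g x)" if x: "x \<in> \<Gamma>" for x
  proof -
    have tang: "has_tangential_gradient \<Gamma> (boundary_trace \<Omega> (\<phi> s)) x (tangential_gradient \<Gamma> (\<psi> s) x)"
      if s: "s \<in> {0<..<T}" for s
      by (rule has_tangential_gradient_cong[THEN iffD2, OF trace_eq[OF s] x C1_surfaceD[OF \<psi>_C1(1)[OF s] x]])
    have "((\<lambda>s. tangential_gradient \<Gamma> (\<psi> s) x) has_vector_derivative g x) (at t)"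
      by (rule has_uniform_derivative_imp_has_vector_derivative[OF grad\<psi>_t x])
    from has_tangential_gradient_time_derivative[OF boundary(2) domain(1) x[unfolded boundary(1)] t
        \<phi>_C1(1) w_C1 grad\<phi>_t tang[unfolded boundary(1)] this[unfolded boundary(1)]]
    have trace: "has_tangential_gradient \<Gamma> (boundary_trace \<Omega> w) x (g x)"
      unfolding boundary(1) by simp
    show ?thesis
      by (rule has_tangential_gradient_cong[THEN iffD1, OF trace_w x trace])
  qed
  have z_C1: "C1_surface \<Gamma> z"
    by (rule C1_surfaceI[OF tangential_z g_cont])

  \<comment> \<open>Continuity of the boundary integrands\<close>
  define c where "c = 1 / measure surface_measure \<Gamma> * (LINT y:\<Gamma>|surface_measure. \<mu>\<^sub>\<Gamma> t y)"
  define \<nu> where "\<nu> = normal_derivative \<Omega> n (\<phi> t)"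
  \<comment> \<open>The evolution law for \<psi> read backwards. Here \<open>c\<close> is just a
    number: integrability of \<open>\<mu>\<^sub>\<Gamma> t\<close> is not presupposed, but follows
    from the continuity that this formula provides.\<close>
  have \<mu>\<^sub>\<Gamma>_z: "\<mu>\<^sub>\<Gamma> t x = c - z x / \<gamma>\<^sub>2" for x
    using constants(3) by (simp add: z_def mean_free_def c_def)
  have z_cont: "continuous_on \<Gamma> z"
    by (rule C1_surface_continuous[OF z_C1])
  have \<mu>\<^sub>\<Gamma>_cont: "continuous_on \<Gamma> (\<mu>\<^sub>\<Gamma> t)"
    unfolding \<mu>\<^sub>\<Gamma>_z using z_cont constants(3) by (intro continuous_intros) auto
  have \<psi>_cont: "continuous_on \<Gamma> (\<psi> s)" "continuous_on \<Gamma> (tangential_gradient \<Gamma> (\<psi> s))"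
    if "s \<in> {0<..<T}" for s
    using \<psi>_C1(1)[OF that] C1_surface_continuous by (auto simp: C1_surface_def)
  have LB_cont: "continuous_on \<Gamma> (laplace_beltrami \<Gamma> (\<psi> t))"
    unfolding laplace_beltrami_def by (rule continuous_on_surface_divergence[OF \<psi>_C1(2)[OF t]])
  have G\<psi>_cont: "continuous_on \<Gamma> (\<lambda>x. deriv G (\<psi> t x))"
    using G(2) \<psi>_cont(1)[OF t] by (rule continuous_on_compose2) simp
  have \<nu>_eq: "\<nu> x = (\<mu>\<^sub>\<Gamma> t x + \<kappa>\<^sup>2 * laplace_beltrami \<Gamma> (\<psi> t) x - deriv G (\<psi> t x)) / \<kappa>\<^sup>2"
    if "x \<in> \<Gamma>" for x
    using \<mu>\<^sub>\<Gamma>_eq[OF t that] constants(4) by (simp add: \<nu>_def)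
  \<comment> \<open>No regularity of \<open>n\<close> is known; the normal derivative is continuous because of the equation.\<close>
  have \<nu>_cont: "continuous_on \<Gamma> \<nu>"
  proof -
    have "continuous_on \<Gamma> (\<lambda>x. (\<mu>\<^sub>\<Gamma> t x + \<kappa>\<^sup>2 * laplace_beltrami \<Gamma> (\<psi> t) x - deriv G (\<psi> t x)) / \<kappa>\<^sup>2)"
      using constants(4) by (intro continuous_intros \<mu>\<^sub>\<Gamma>_cont LB_cont G\<psi>_cont) auto
    then show ?thesis
      by (rule continuous_on_cong[THEN iffD1, rotated 2]) (simp_all add: \<nu>_eq)
  qed

  have bulk_bc: "bounded_continuous_on \<Omega> w" "bounded_continuous_on \<Omega> (gradient w)"
    "bounded_continuous_on \<Omega> (laplacian (\<phi> t))" "bounded_continuous_on \<Omega> (\<mu> t)"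
    using bc\<^sub>\<Omega>[OF uc[OF w_C1]] bc\<^sub>\<Omega>[OF C1_closure_gradient[OF w_C1]]
      bounded_continuous_on_laplacian[OF domain(3) regularity_\<phi>(1)[OF t]]
      bc\<^sub>\<Omega>[OF uc[OF regularity_\<mu>[OF t]]] by this
  have \<phi>_bc: "bounded_continuous_on \<Omega> (\<phi> s)" "bounded_continuous_on \<Omega> (gradient (\<phi> s))"
    if "s \<in> {0<..<T}" for s
    using bc\<^sub>\<Omega>[OF uc[OF \<phi>_C1(1)[OF that]]] bc\<^sub>\<Omega>[OF uc[OF \<phi>_C1(2)[OF that]]] by this
  have F\<phi>_bc: "bounded_continuous_on \<Omega> (\<lambda>x. deriv double_well (\<phi> t x))"
    by (intro bounded_continuous_on_compose[OF \<phi>_bc(1)[OF t]] F(2)) simp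

  let ?w\<phi> = "LINT x:\<Omega>|lborel. w x * laplacian (\<phi> t) x"
  let ?wF = "LINT x:\<Omega>|lborel. w x * deriv double_well (\<phi> t x)"
  let ?ww = "LINT x:\<Omega>|lborel. gradient w x \<bullet> gradient (\<phi> t) x"
  let ?z\<psi> = "LINT x:\<Gamma>|surface_measure. z x * laplace_beltrami \<Gamma> (\<psi> t) x"
  let ?zG = "LINT x:\<Gamma>|surface_measure. z x * deriv G (\<psi> t x)"
  let ?zz = "LINT x:\<Gamma>|surface_measure. g x \<bullet> tangential_gradient \<Gamma> (\<psi> t) x"
  let ?z\<nu> = "LINT x:\<Gamma>|surface_measure. z x * \<nu> x"

  \<comment> \<open>Derivative of the energy\<close>
  have "((\<lambda>s. LINT x:\<Omega>|lborel. \<kappa>\<^sup>2 / 2 * (norm (gradient (\<phi> s) x))\<^sup>2 + double_well (\<phi> s x))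
      has_real_derivative \<kappa>\<^sup>2 * ?ww + ?wF) (at t)"
    by (rule has_derivative_energy[OF \<Omega> t \<phi>_bc(1) bulk_bc(1) \<phi>_t \<phi>_bc(2) bulk_bc(2) grad\<phi>_t])
      (use F in auto)
  moreover have "((\<lambda>s. LINT x:\<Gamma>|surface_measure.
      \<kappa>\<^sup>2 / 2 * (norm (tangential_gradient \<Gamma> (\<psi> s) x))\<^sup>2 + G (\<psi> s x))
      has_real_derivative \<kappa>\<^sup>2 * ?zz + ?zG) (at t)"
    by (rule has_derivative_energy[OF \<Gamma> t bc\<^sub>\<Gamma>[OF \<psi>_cont(1)] bc\<^sub>\<Gamma>[OF z_cont] \<psi>_t
          bc\<^sub>\<Gamma>[OF \<psi>_cont(2)] bc\<^sub>\<Gamma>[OF g_cont] grad\<psi>_t G])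
  ultimately have deriv: "((\<lambda>s. total_energy \<kappa> G \<Omega> (\<phi> s) (\<psi> s)) has_real_derivative
      (\<kappa>\<^sup>2 * ?ww + ?wF) + (\<kappa>\<^sup>2 * ?zz + ?zG)) (at t)"
    unfolding total_energy_def boundary(1)[symmetric] by (rule DERIV_add)

  \<comment> \<open>Green's formulas\<close>
  have green_bulk: "?w\<phi> + ?ww = ?z\<nu>"
  proof -
    let ?V = "\<lambda>x. w x *\<^sub>R gradient (\<phi> t) x"
    have "?w\<phi> + ?ww = (LINT x:\<Omega>|lborel. w x * laplacian (\<phi> t) x + gradient w x \<bullet> gradient (\<phi> t) x)"
      by (intro set_integral_add(2)[symmetric] int\<^sub>\<Omega> bounded_continuous_on_mult
          bounded_continuous_on_inner bulk_bc \<phi>_bc t)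
    also have "\<dots> = (LINT x:\<Omega>|lborel. divergence ?V x)"
    proof (rule set_lebesgue_integral_cong)
      show "\<forall>x. x \<in> \<Omega> \<longrightarrow> w x * laplacian (\<phi> t) x + gradient w x \<bullet> gradient (\<phi> t) x = divergence ?V x"
        using w_C1 \<phi>_C1(2)[OF t] by (simp add: divergence_scaleR C1_closure_def laplacian_def)
    qed (use \<Omega> in simp)
    also have "\<dots> = (LINT x:\<Gamma>|surface_measure. boundary_trace \<Omega> ?V x \<bullet> n x)"
      using gauss_green(1) C1_closure_scaleR[OF domain(3) w_C1 \<phi>_C1(2)[OF t]] boundary(1)
      by (simp add: gauss_green_bulk_def)
    also have "\<dots> = ?z\<nu>"
    proof (rule set_lebesgue_integral_cong)
      have "boundary_trace \<Omega> ?V x = z x *\<^sub>R boundary_trace \<Omega> (gradient (\<phi> t)) x" if x: "x \<in> \<Gamma>" for x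
        unfolding trace_w[OF x, symmetric] using x boundary(1)
        by (intro boundary_trace_eqI tendsto_scaleR boundary_trace_tendsto domain(1) uc w_C1 \<phi>_C1(2)[OF t]) auto
      then show "\<forall>x. x \<in> \<Gamma> \<longrightarrow> boundary_trace \<Omega> ?V x \<bullet> n x = z x * \<nu> x"
        by (simp add: \<nu>_def normal_derivative_def)
    qed (use \<Gamma> in simp)
    finally show ?thesis .
  qed

  have green_surface: "?z\<psi> + ?zz = 0"
  proof -
    let ?V = "\<lambda>x. z x *\<^sub>R tangential_gradient \<Gamma> (\<psi> t) x"
    have "?z\<psi> + ?zz = (LINT x:\<Gamma>|surface_measure.
        z x * laplace_beltrami \<Gamma> (\<psi> t) x + g x \<bullet> tangential_gradient \<Gamma> (\<psi> t) x)"
      by (intro set_integral_add(2)[symmetric] int\<^sub>\<Gamma> bc\<^sub>\<Gamma> continuous_intros z_cont g_cont LB_cont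
          \<psi>_cont t)
    also have "\<dots> = (LINT x:\<Gamma>|surface_measure. surface_divergence \<Gamma> ?V x)"
    proof (rule set_lebesgue_integral_cong)
      show "\<forall>x. x \<in> \<Gamma> \<longrightarrow> z x * laplace_beltrami \<Gamma> (\<psi> t) x + g x \<bullet> tangential_gradient \<Gamma> (\<psi> t) x
          = surface_divergence \<Gamma> ?V x"
        by (simp add: surface_divergence_scaleR[OF z_C1 \<psi>_C1(2)[OF t]] laplace_beltrami_def
            tangential_gradient_eqI[OF tangential_z])
    qed (use \<Gamma> in simp)
    also have "\<dots> = 0"
      using gauss_green(2) C1_tangential_field_scaleR[OF z_C1 \<psi>_C1(2)[OF t]]
      by (simp add: gauss_green_surface_def)
    finally show ?thesis .
  qed

  \<comment> \<open>Substitution of the equations\<close>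
  have bulk: "- \<kappa>\<^sup>2 * ?w\<phi> + ?wF = - \<gamma>\<^sub>1 * (LINT x:\<Omega>|lborel. \<mu> t x * proj_bulk \<Omega> (\<mu> t) x)"
  proof -
    have "- \<kappa>\<^sup>2 * ?w\<phi> + ?wF = (LINT x:\<Omega>|lborel. - \<kappa>\<^sup>2 * (w x * laplacian (\<phi> t) x))
        + (LINT x:\<Omega>|lborel. w x * deriv double_well (\<phi> t x))"
      by (simp only: set_integral_mult_right)
    also have "\<dots> = (LINT x:\<Omega>|lborel. - \<kappa>\<^sup>2 * (w x * laplacian (\<phi> t) x) + w x * deriv double_well (\<phi> t x))"
      by (intro set_integral_add(2)[symmetric] set_integrable_mult_right int\<^sub>\<Omega>
          bounded_continuous_on_mult bulk_bc F\<phi>_bc)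
    also have "\<dots> = (LINT x:\<Omega>|lborel. - \<gamma>\<^sub>1 * (\<mu> t x * proj_bulk \<Omega> (\<mu> t) x))"
    proof (rule set_lebesgue_integral_cong)
      have "- \<kappa>\<^sup>2 * (w x * laplacian (\<phi> t) x) + w x * deriv double_well (\<phi> t x) = w x * \<mu> t x"
        if "x \<in> \<Omega>" for x
        unfolding \<mu>_eq[OF t that] by (simp add: algebra_simps)
      then show "\<forall>x. x \<in> \<Omega> \<longrightarrow> - \<kappa>\<^sup>2 * (w x * laplacian (\<phi> t) x) + w x * deriv double_well (\<phi> t x)
          = - \<gamma>\<^sub>1 * (\<mu> t x * proj_bulk \<Omega> (\<mu> t) x)"
        by (simp add: w_def)
    qed (use \<Omega> in simp)
    finally show ?thesis by (simp only: set_integral_mult_right)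
  qed

  have surface: "- \<kappa>\<^sup>2 * ?z\<psi> + ?zG + \<kappa>\<^sup>2 * ?z\<nu>
      = - \<gamma>\<^sub>2 * (LINT x:\<Gamma>|surface_measure. \<mu>\<^sub>\<Gamma> t x * proj_surface \<Gamma> (\<mu>\<^sub>\<Gamma> t) x)"
  proof -
    \<comment> \<open>Splitting the integral requires each of the three terms to be integrable; for
      the last one this rests on \<open>\<nu>_cont\<close>.\<close>
    have cont: "continuous_on \<Gamma> (\<lambda>x. z x * laplace_beltrami \<Gamma> (\<psi> t) x)"
      "continuous_on \<Gamma> (\<lambda>x. z x * deriv G (\<psi> t x))" "continuous_on \<Gamma> (\<lambda>x. z x * \<nu> x)"
      by (intro continuous_intros z_cont LB_cont G\<psi>_cont \<nu>_cont)+
    note i = int\<^sub>\<Gamma>[OF bc\<^sub>\<Gamma>[OF cont(1)]] int\<^sub>\<Gamma>[OF bc\<^sub>\<Gamma>[OF cont(2)]] int\<^sub>\<Gamma>[OF bc\<^sub>\<Gamma>[OF cont(3)]]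
    have "- \<kappa>\<^sup>2 * ?z\<psi> + ?zG + \<kappa>\<^sup>2 * ?z\<nu> =
        (LINT x:\<Gamma>|surface_measure. - \<kappa>\<^sup>2 * (z x * laplace_beltrami \<Gamma> (\<psi> t) x))
        + (LINT x:\<Gamma>|surface_measure. z x * deriv G (\<psi> t x))
        + (LINT x:\<Gamma>|surface_measure. \<kappa>\<^sup>2 * (z x * \<nu> x))"
      by (simp only: set_integral_mult_right)
    also have "\<dots> = (LINT x:\<Gamma>|surface_measure. - \<kappa>\<^sup>2 * (z x * laplace_beltrami \<Gamma> (\<psi> t) x)
        + z x * deriv G (\<psi> t x) + \<kappa>\<^sup>2 * (z x * \<nu> x))"
      by (simp only: set_integral_add[OF set_integral_add(1)[OF set_integrable_mult_right[OF i(1)] i(2)]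
            set_integrable_mult_right[OF i(3)]] set_integral_add[OF set_integrable_mult_right[OF i(1)] i(2)])
    also have "\<dots> = (LINT x:\<Gamma>|surface_measure. - \<gamma>\<^sub>2 * (\<mu>\<^sub>\<Gamma> t x * proj_surface \<Gamma> (\<mu>\<^sub>\<Gamma> t) x))"
    proof (rule set_lebesgue_integral_cong)
      have "- \<kappa>\<^sup>2 * (z x * laplace_beltrami \<Gamma> (\<psi> t) x) + z x * deriv G (\<psi> t x) + \<kappa>\<^sup>2 * (z x * \<nu> x)
          = z x * \<mu>\<^sub>\<Gamma> t x" if "x \<in> \<Gamma>" for x
        unfolding \<mu>\<^sub>\<Gamma>_eq[OF t that] \<nu>_def by (simp add: algebra_simps)
      then show "\<forall>x. x \<in> \<Gamma> \<longrightarrow> - \<kappa>\<^sup>2 * (z x * laplace_beltrami \<Gamma> (\<psi> t) x)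
          + z x * deriv G (\<psi> t x) + \<kappa>\<^sup>2 * (z x * \<nu> x) = - \<gamma>\<^sub>2 * (\<mu>\<^sub>\<Gamma> t x * proj_surface \<Gamma> (\<mu>\<^sub>\<Gamma> t) x)"
        by (simp add: z_def)
    qed (use \<Gamma> in simp)
    finally show ?thesis by (simp only: set_integral_mult_right)
  qed

  have "0 \<le> \<gamma>\<^sub>1 * (LINT x:\<Omega>|lborel. \<mu> t x * proj_bulk \<Omega> (\<mu> t) x)"
    using constants(2) integral_mean_free_nonneg[OF \<Omega> bulk_bc(4)] by (intro mult_nonneg_nonneg) auto
  moreover have "0 \<le> \<gamma>\<^sub>2 * (LINT x:\<Gamma>|surface_measure. \<mu>\<^sub>\<Gamma> t x * proj_surface \<Gamma> (\<mu>\<^sub>\<Gamma> t) x)"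
    using constants(3) integral_mean_free_nonneg[OF \<Gamma> bc\<^sub>\<Gamma>[OF \<mu>\<^sub>\<Gamma>_cont]] by (intro mult_nonneg_nonneg) auto
  \<comment> \<open>The flux \<open>?z\<nu>\<close> left over by Green's formula in the bulk is
    exactly the coupling term that \<open>surface\<close> needs to assemble
    \<open>\<mu>\<^sub>\<Gamma>\<close>.\<close>
  moreover have "\<kappa>\<^sup>2 * ?ww = \<kappa>\<^sup>2 * ?z\<nu> - \<kappa>\<^sup>2 * ?w\<phi>"
    unfolding green_bulk[symmetric] by (simp add: algebra_simps)
  moreover have "\<kappa>\<^sup>2 * ?zz = - \<kappa>\<^sup>2 * ?z\<psi>"
    using green_surface by (simp add: add_eq_0_iff)
  ultimately have "(\<kappa>\<^sup>2 * ?ww + ?wF) + (\<kappa>\<^sup>2 * ?zz + ?zG) \<le> 0"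
    using bulk surface by linarith
  with deriv show "\<exists>D. ((\<lambda>s. total_energy \<kappa> G \<Omega> (\<phi> s) (\<psi> s)) has_real_derivative D) (at t) \<and> D \<le> 0"
    by blast
qed

end
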